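(* Let $H$ be a fixed graph with $d = |V(H)|$ vertices. Then $H$-Packing($k$) admits a logspace kernelization that runs in time $O(|E| \cdot \binom{|V|}{d}^{d+1})$ and outputs an equivalent instance with at most $\frac{d(d-1)}{2}(d(k-1)+1)^d$ edges.
   Context: $H$-Packing($k$): given a graph $G=(V,E)$ and $k \in \mathbb{N}$ (the parameter), decide whether $G$ contains $k$ pairwise vertex-disjoint occurrences of $H$ (e.g. for $H$ a triangle, $k$ vertex-disjoint triangles). A kernelization for a parameterized problem is an algorithm that, given an instance $(x,k)$, computes in time polynomial in $|x|+k$ an instance $(x',k')$ with $|x'|+k' \leq g(k)$ for some computable $g$ such that $(x,k)$ is a yes-instance iff $(x',k')$ is a yes-instance (an equivalent instance). A logspace kernelization is a kernelization that uses only logarithmic working space (read-only input, write-only output). *)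

theory Defs
  imports Main "HOL-Library.Discrete_Functions"
begin

section \<open>Graphs and packings\<close>

type_synonym 'a ugraph = "'a set \<times> 'a set set"

abbreviation verts :: "'a ugraph \<Rightarrow> 'a set" where "verts \<equiv> fst"
abbreviation edges :: "'a ugraph \<Rightarrow> 'a set set" where "edges \<equiv> snd"

definition simple_graph :: "'a ugraph \<Rightarrow> bool" where
  "simple_graph G \<longleftrightarrow>
     finite (verts G) \<and> edges G \<subseteq> {e. e \<subseteq> verts G \<and> card e = 2}"

definition subgraph :: "'a ugraph \<Rightarrow> 'a ugraph \<Rightarrow> bool" where
  "subgraph S G \<longleftrightarrow> simple_graph S \<and> verts S \<subseteq> verts G \<and> edges S \<subseteq> edges G"

definition isomorphic :: "'a ugraph \<Rightarrow> 'b ugraph \<Rightarrow> bool" where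
  "isomorphic H S \<longleftrightarrow>
     (\<exists>f. bij_betw f (verts H) (verts S) \<and> (\<lambda>e. f ` e) ` edges H = edges S)"

text \<open>Occurrences are subgraphs, not necessarily induced ones.\<close>

definition occurrence :: "'a ugraph \<Rightarrow> 'b ugraph \<Rightarrow> 'b ugraph \<Rightarrow> bool" where
  "occurrence H S G \<longleftrightarrow> subgraph S G \<and> isomorphic H S"

definition H_packing :: "'a ugraph \<Rightarrow> ('b ugraph \<times> nat) set" where
  "H_packing H = {(G, k). \<exists>S :: nat \<Rightarrow> 'b ugraph.
     (\<forall>i<k. occurrence H (S i) G) \<and>
     (\<forall>i<k. \<forall>j<k. i \<noteq> j \<longrightarrow> verts (S i) \<inter> verts (S j) = {})}"

text \<open>The graphs given as input to algorithms have an initial segment of the natural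
  numbers as vertex set. They are coded by the number of vertices followed by the rows of the
  adjacency matrix.\<close>

definition input_graphs :: "nat ugraph set" where
  "input_graphs = {G. simple_graph G \<and> (\<exists>n. verts G = {..<n})}"

definition graph_code :: "nat ugraph \<Rightarrow> nat list" where
  "graph_code G = (let n = card (verts G) in
     n # map (\<lambda>(i, j). of_bool ({i, j} \<in> edges G)) (List.product [0..<n] [0..<n]))"

lemma inj_on_graph_code: "inj_on graph_code input_graphs"
proof (rule inj_onI)
  fix G G' assume G: "G \<in> input_graphs" "G' \<in> input_graphs"
    and eq: "graph_code G = graph_code G'"
  obtain n n' where n: "verts G = {..<n}" "verts G' = {..<n'}"
    using G by (auto simp: input_graphs_def)
  have nn: "n = n'" using eq n by (simp add: graph_code_def Let_def)
  have "(of_bool ({i, j} \<in> edges G) :: nat) = of_bool ({i, j} \<in> edges G')"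
    if "i < n" "j < n" for i j
    using eq n nn that by (auto simp: graph_code_def Let_def)
  then have pair: "{i, j} \<in> edges G \<longleftrightarrow> {i, j} \<in> edges G'" if "i < n" "j < n" for i j
    using that by (metis of_bool_eq_iff)
  have edge: "\<exists>i j. e = {i, j} \<and> i < n \<and> j < n" if "e \<in> edges G \<or> e \<in> edges G'" for e
  proof -
    have "e \<subseteq> {..<n}" "card e = 2"
      using that G n nn by (auto simp: input_graphs_def simple_graph_def)
    then show ?thesis by (auto simp: card_2_iff)
  qed
  have "edges G = edges G'" using pair edge by blast
  then show "G = G'" using n nn by (simp add: prod_eq_iff)
qed


section \<open>A random access machine with read-only input and write-only output\<close>

text \<open>Programs have finitely many work registers holding natural numbers, no other work
  memory, and no indirect addressing of the registers. The input is a read-only array of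
  natural numbers with random access, the output an append-only list. Every instruction and
  every test takes unit time; there is no a priori bound on the size of a register, but the
  number of bits in all registers together is charged as space.\<close>

type_synonym reg = nat
type_synonym store = "reg \<Rightarrow> nat"

datatype instr =
    Const reg nat
  | Add reg reg reg
  | Sub reg reg reg
  | Mult reg reg reg
  | Read reg reg
  | Write reg

datatype prog =
    Skip
  | Do instr
  | Seq prog prog
  | IfLess reg reg prog prog
  | WhileLess reg reg prog

fun instr_regs :: "instr \<Rightarrow> reg set" where
  "instr_regs (Const r n) = {r}"
| "instr_regs (Add r p q) = {r, p, q}"
| "instr_regs (Sub r p q) = {r, p, q}"
| "instr_regs (Mult r p q) = {r, p, q}"
| "instr_regs (Read r p) = {r, p}"
| "instr_regs (Write p) = {p}"

fun regs :: "prog \<Rightarrow> reg set" where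
  "regs Skip = {}"
| "regs (Do i) = instr_regs i"
| "regs (Seq c1 c2) = regs c1 \<union> regs c2"
| "regs (IfLess p q c1 c2) = {p, q} \<union> regs c1 \<union> regs c2"
| "regs (WhileLess p q c) = {p, q} \<union> regs c"

text \<open>Subtraction is truncated at zero, and reading beyond the end of the input yields zero.\<close>

fun exec_instr :: "nat list \<Rightarrow> instr \<Rightarrow> store \<Rightarrow> store" where
  "exec_instr x (Const r n) s = s(r := n)"
| "exec_instr x (Add r p q) s = s(r := s p + s q)"
| "exec_instr x (Sub r p q) s = s(r := s p - s q)"
| "exec_instr x (Mult r p q) s = s(r := s p * s q)"
| "exec_instr x (Read r p) s = s(r := (if s p < length x then x ! s p else 0))"
| "exec_instr x (Write p) s = s"

fun emitted :: "instr \<Rightarrow> store \<Rightarrow> nat list" where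
  "emitted (Write p) s = [s p]"
| "emitted _ s = []"

text \<open>Length of the binary representation, where 0 has one digit.\<close>

definition nbits :: "nat \<Rightarrow> nat" where
  "nbits n = floor_log n + 1"

definition mem_bits :: "reg set \<Rightarrow> store \<Rightarrow> nat" where
  "mem_bits R s = (\<Sum>r\<in>R. nbits (s r))"

text \<open>In \<open>run x R c s ys t b s'\<close>, the program \<open>c\<close> with input \<open>x\<close>, started in store \<open>s\<close>, halts
  in store \<open>s'\<close> after \<open>t\<close> steps and has then appended \<open>ys\<close> to the output; \<open>b\<close> is the maximum of
  \<open>mem_bits R\<close> over all stores passed through, including the first and the last one.\<close>

inductive run ::
  "nat list \<Rightarrow> reg set \<Rightarrow> prog \<Rightarrow> store \<Rightarrow> nat list \<Rightarrow> nat \<Rightarrow> nat \<Rightarrow> store \<Rightarrow> bool"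
  for x :: "nat list" and R :: "reg set"
where
  Skip: "run x R Skip s [] 1 (mem_bits R s) s"
| Do: "s' = exec_instr x i s \<Longrightarrow>
    run x R (Do i) s (emitted i s) 1 (max (mem_bits R s) (mem_bits R s')) s'"
| Seq: "run x R c1 s ys1 t1 b1 s1 \<Longrightarrow> run x R c2 s1 ys2 t2 b2 s2 \<Longrightarrow>
    run x R (Seq c1 c2) s (ys1 @ ys2) (t1 + t2) (max b1 b2) s2"
| IfTrue: "s p < s q \<Longrightarrow> run x R c1 s ys t b s' \<Longrightarrow>
    run x R (IfLess p q c1 c2) s ys (1 + t) b s'"
| IfFalse: "\<not> s p < s q \<Longrightarrow> run x R c2 s ys t b s' \<Longrightarrow>
    run x R (IfLess p q c1 c2) s ys (1 + t) b s'"
| WhileFalse: "\<not> s p < s q \<Longrightarrow> run x R (WhileLess p q c) s [] 1 (mem_bits R s) s"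
| WhileTrue: "s p < s q \<Longrightarrow> run x R c s ys1 t1 b1 s1 \<Longrightarrow>
    run x R (WhileLess p q c) s1 ys2 t2 b2 s2 \<Longrightarrow>
    run x R (WhileLess p q c) s (ys1 @ ys2) (1 + t1 + t2) (max b1 b2) s2"

lemma run_deterministic:
  "run x R c s ys t b s' \<Longrightarrow> run x R c s ys' t' b' s'' \<Longrightarrow>
     ys' = ys \<and> t' = t \<and> b' = b \<and> s'' = s'"
proof (induction arbitrary: ys' t' b' s'' rule: run.induct)
  case Skip
  from Skip.prems show ?case by cases auto
next
  case Do
  from Do.prems Do.hyps show ?case by cases auto
next
  case Seq
  from Seq.prems show ?case by cases (use Seq.IH in blast)
next
  case IfTrue
  from IfTrue.prems show ?case by cases (use IfTrue in blast)+
next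
  case IfFalse
  from IfFalse.prems show ?case by cases (use IfFalse in blast)+
next
  case WhileFalse
  from WhileFalse.prems WhileFalse.hyps show ?case by cases auto
next
  case WhileTrue
  from WhileTrue.prems show ?case by cases (use WhileTrue in blast)+
qed

text \<open>\<open>computes P x ys t b\<close>: on input \<open>x\<close> and with all registers initially zero, \<open>P\<close> halts with
  output \<open>ys\<close> after \<open>t\<close> steps using \<open>b\<close> bits of work space.\<close>

definition computes :: "prog \<Rightarrow> nat list \<Rightarrow> nat list \<Rightarrow> nat \<Rightarrow> nat \<Rightarrow> bool" where
  "computes P x ys t b \<longleftrightarrow> (\<exists>s'. run x (regs P) P (\<lambda>_. 0) ys t b s')"

definition computable :: "(nat \<Rightarrow> nat) \<Rightarrow> bool" where
  "computable g \<longleftrightarrow> (\<exists>Q. \<forall>k. \<exists>t b. computes Q [k] [g k] t b)"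


section \<open>Kernelization\<close>

text \<open>A parameterized problem \<open>L\<close> consists of pairs \<open>(x, k)\<close> with \<open>x\<close> from a set \<open>X\<close> of
  instances, coded as lists of numbers by \<open>enc\<close>. The size of \<open>x\<close> is the total number of bits
  of its code, not the number of list entries.\<close>

definition code_size :: "nat list \<Rightarrow> nat" where
  "code_size x = (\<Sum>w\<leftarrow>x. nbits w)"

definition transforms ::
  "('i \<Rightarrow> nat list) \<Rightarrow> prog \<Rightarrow> 'i \<times> nat \<Rightarrow> 'i \<times> nat \<Rightarrow> nat \<Rightarrow> nat \<Rightarrow> bool" where
  "transforms enc P I I' t b \<longleftrightarrow>
     computes P (snd I # enc (fst I)) (snd I' # enc (fst I')) t b"

definition kernelization ::
  "('i \<Rightarrow> nat list) \<Rightarrow> 'i set \<Rightarrow> ('i \<times> nat) set \<Rightarrow> prog \<Rightarrow> bool" where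
  "kernelization enc X L P \<longleftrightarrow>
     (\<exists>g c. computable g \<and>
       (\<forall>x\<in>X. \<forall>k. \<exists>x'\<in>X. \<exists>k' t b.
          transforms enc P (x, k) (x', k') t b \<and>
          t \<le> c * (code_size (enc x) + k) ^ c + c \<and>
          code_size (enc x') + k' \<le> g k \<and>
          ((x, k) \<in> L \<longleftrightarrow> (x', k') \<in> L)))"

definition logspace_kernelization ::
  "('i \<Rightarrow> nat list) \<Rightarrow> 'i set \<Rightarrow> ('i \<times> nat) set \<Rightarrow> prog \<Rightarrow> bool" where
  "logspace_kernelization enc X L P \<longleftrightarrow>
     kernelization enc X L P \<and>
     (\<exists>c. \<forall>x\<in>X. \<forall>k. \<exists>ys t b.
        computes P (k # enc x) ys t b \<and> b \<le> c * nbits (code_size (enc x) + k))"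

end

theory Submission
  imports Defs "HOL-Library.Nat_Bijection" "HOL-Library.Disjoint_Sets"
begin

text \<open>Let \<open>F\<close> be the family of the \<open>d\<close>-element vertex sets that carry a copy of \<open>H\<close>, and let
  \<open>t = d(k - 1) + 1\<close>. Put \<open>F\<^sub>0 = F\<close>, and let \<open>F\<^sub>l\<close> consist of the sets of \<open>F\<^bsub>l-1\<^esub>\<close> that, for each of
  their subsets \<open>C\<close> of size \<open>d - l\<close>, are among the first \<open>t\<^sup>l\<close> sets of \<open>F\<^bsub>l-1\<^esub>\<close> containing \<open>C\<close>. Then at
  most \<open>t\<^sup>l\<close> sets of \<open>F\<^sub>l\<close> contain a given set of size \<open>d - l\<close>; in particular \<open>F\<^sub>d\<close> has at most
  \<open>t\<^sup>d\<close> members. A packing survives each step by an exchange argument. The kernel consists of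
  the vertices and edges of \<open>G\<close> inside members of \<open>F\<^sub>d\<close>.

  Unlike in a greedy sunflower reduction, membership in \<open>F\<^sub>l\<close> does not depend on earlier decisions,
  so it is decided by \<open>l\<close> nested counting loops over the extensions of \<open>C\<close>. These have \<open>l\<close> vertices,
  which gives loop depth \<open>1 + \<dots> + d\<close>; together with the \<open>d + 1\<close> loops of the output routine this
  is at most \<open>d(d + 1)\<close> if \<open>d \<ge> 2\<close>. Bounded loops over polynomially bounded values make time and
  space of the compiled program a matter of syntax.\<close>

section \<open>Counting expressions and their compilation\<close>

text \<open>Cores are treated from large to small because of what the exchange needs. A set that
  contains a core \<open>C\<close> and meets the rest of the packing in a vertex \<open>z\<close>
  contains \<open>C\<close> together with \<open>z\<close>, a core larger by one, and the previous
  level has bounded how many sets do so. The other \<open>k - 1\<close> sets have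
  \<open>d * (k - 1)\<close> vertices, so each bound must exceed \<open>d * (k - 1)\<close> times
  the one before; \<open>t\<close> is the least such factor.

  The machine has no stack, no indirect addressing of registers, and only logarithmically many bits.
  Hence everything whose size depends on \<open>H\<close> alone (maps from \<open>H\<close>, cores
  inside a set, the recursion on the level) is unrolled into the program text, and a set is held as
  a tuple of \<open>d\<close> registers. The code that orders the sets may need as many bits as
  there are vertices, so the order is decided by comparing elements.

  Loop depth \<open>d * (d + 1)\<close> is the target because \<open>(n + 1) ^ (d * (d + 1))\<close>
  is the \<open>(d + 1)\<close>-st power of \<open>(n + 1) ^ d\<close>, which is at most a constant
  depending on \<open>d\<close> times \<open>max 1 (n choose d)\<close>.\<close>

datatype bop = PlusOp | MinusOp | TimesOp | LessOp

text \<open>\<open>Sum\<close> is the only iteration. It counts, and since truth is coded by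
  positivity it is an existential quantifier as well.\<close>

datatype exp = V nat | N nat | Op bop exp exp | Rd exp | Sum nat exp

fun apply_op :: "bop \<Rightarrow> nat \<Rightarrow> nat \<Rightarrow> nat" where
  "apply_op PlusOp a b = a + b"
| "apply_op MinusOp a b = a - b"
| "apply_op TimesOp a b = a * b"
| "apply_op LessOp a b = of_bool (a < b)"

primrec eval :: "nat list \<Rightarrow> exp \<Rightarrow> store \<Rightarrow> nat" where
  "eval x (V v) s = s v"
| "eval x (N c) s = c"
| "eval x (Op f a b) s = apply_op f (eval x a s) (eval x b s)"
| "eval x (Rd a) s = (if eval x a s < length x then x ! eval x a s else 0)"
| "eval x (Sum v a) s = (\<Sum>j<s 0. eval x a (s(v := j)))"

text \<open>Register 0 holds the number of vertices, which bounds every loop. Bound variables are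
  de Bruijn levels, so that sibling subexpressions may reuse registers.\<close>

primrec wf_exp :: "nat \<Rightarrow> exp \<Rightarrow> bool" where
  "wf_exp m (V v) \<longleftrightarrow> v < m"
| "wf_exp m (N c) \<longleftrightarrow> True"
| "wf_exp m (Op f a b) \<longleftrightarrow> wf_exp m a \<and> wf_exp m b"
| "wf_exp m (Rd a) \<longleftrightarrow> wf_exp m a"
| "wf_exp m (Sum v a) \<longleftrightarrow> v = m \<and> wf_exp (Suc m) a"

primrec bound_vars :: "exp \<Rightarrow> nat set" where
  "bound_vars (V v) = {}"
| "bound_vars (N c) = {}"
| "bound_vars (Op f a b) = bound_vars a \<union> bound_vars b"
| "bound_vars (Rd a) = bound_vars a"
| "bound_vars (Sum v a) = insert v (bound_vars a)"

primrec depth :: "exp \<Rightarrow> nat" where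
  "depth (V v) = 0"
| "depth (N c) = 0"
| "depth (Op f a b) = max (depth a) (depth b)"
| "depth (Rd a) = depth a"
| "depth (Sum v a) = Suc (depth a)"

text \<open>The weights count machine steps. A copy takes two, as there is no move instruction;
  \<open>LessOp\<close> needs a test and a constant; a loop round spends four besides its body: the
  test, the accumulation, and an increment whose constant is reloaded.\<close>

primrec cost :: "exp \<Rightarrow> nat" where
  "cost (V v) = 2"
| "cost (N c) = 1"
| "cost (Op f a b) = cost a + cost b + 2"
| "cost (Rd a) = cost a + 1"
| "cost (Sum v a) = cost a + 4"

primrec max_const :: "exp \<Rightarrow> nat" where
  "max_const (V v) = 0"
| "max_const (N c) = c"
| "max_const (Op f a b) = max (max_const a) (max_const b)"
| "max_const (Rd a) = max_const a"
| "max_const (Sum v a) = max_const a"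

text \<open>An exponent: if all data are at most \<open>X\<close>, with \<open>2 \<le> X\<close>,
  the value is at most \<open>X ^ growth a\<close>. It never decreases towards larger expressions,
  so it controls intermediate values too.\<close>

primrec growth :: "exp \<Rightarrow> nat" where
  "growth (V v) = 1"
| "growth (N c) = 1"
| "growth (Op f a b) = growth a + growth b"
| "growth (Rd a) = growth a + 1"
| "growth (Sum v a) = growth a + 1"

fun comp_op :: "bop \<Rightarrow> reg \<Rightarrow> prog" where
  "comp_op PlusOp r = Do (Add r r (Suc r))"
| "comp_op MinusOp r = Do (Sub r r (Suc r))"
| "comp_op TimesOp r = Do (Mult r r (Suc r))"
| "comp_op LessOp r = IfLess r (Suc r) (Do (Const r 1)) (Do (Const r 0))"

text \<open>A stack discipline: the result goes to \<open>r\<close>, a second operand to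
  \<open>Suc r\<close>, and everything from \<open>r\<close> upwards is scratch, while loop
  variables keep their own numbers below \<open>r\<close>. In \<open>WhileLess v 0\<close> the
  \<open>0\<close> is a register number, namely that of the loop bound.\<close>

primrec comp_exp :: "reg \<Rightarrow> exp \<Rightarrow> prog" where
  "comp_exp r (V v) = Seq (Do (Const r 0)) (Do (Add r r v))"
| "comp_exp r (N c) = Do (Const r c)"
| "comp_exp r (Op f a b) = Seq (comp_exp r a) (Seq (comp_exp (Suc r) b) (comp_op f r))"
| "comp_exp r (Rd a) = Seq (comp_exp r a) (Do (Read r r))"
| "comp_exp r (Sum v a) = Seq (Do (Const r 0)) (Seq (Do (Const v 0))
     (WhileLess v 0 (Seq (comp_exp (Suc r) a) (Seq (Do (Add r r (Suc r)))
       (Seq (Do (Const (Suc r) 1)) (Do (Add v v (Suc r))))))))"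

lemma wf_exp_bound_vars: "wf_exp m a \<Longrightarrow> v \<in> bound_vars a \<Longrightarrow> m \<le> v"
  by (induction a arbitrary: m) fastforce+

lemma finite_bound_vars: "finite (bound_vars a)"
  by (induction a) auto

text \<open>Register 0 has to be among the agreeing ones, as every \<open>Sum\<close> reads its
  bound there.\<close>

lemma eval_cong: "wf_exp m a \<Longrightarrow> 0 < m \<Longrightarrow> (\<And>q. q < m \<Longrightarrow> s q = s' q) \<Longrightarrow> eval x a s = eval x a s'"
proof (induction a arbitrary: m s s')
  case (Sum v a)
  have "eval x a (s(v := j)) = eval x a (s'(v := j))" for j
    by (rule Sum.IH[of "Suc m"]) (use Sum.prems in auto)
  then show ?case using Sum.prems by simp
next
  case (Op f a b)
  have "eval x a s = eval x a s'" "eval x b s = eval x b s'"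
    using Op.prems by (auto intro!: Op.IH[of m])
  then show ?case by simp
next
  case (Rd a)
  have "eval x a s = eval x a s'"
    using Rd.prems by (auto intro!: Rd.IH[of m])
  then show ?case by simp
qed auto

lemma growth_pos: "0 < growth a"
  by (induction a) auto

lemma apply_op_le:
  assumes "a \<le> X ^ p" "b \<le> X ^ q" "2 \<le> X" "1 \<le> p" "1 \<le> q"
  shows "apply_op f a b \<le> X ^ (p + q)"
proof -
  have p: "2 \<le> X ^ p" "2 \<le> X ^ q"
    using assms by (metis order_trans self_le_power Suc_1 Suc_le_eq One_nat_def less_imp_le_nat zero_less_Suc)+
  \<comment> \<open>A sum is absorbed by the product once both terms are at least 2; hence
    \<open>2 \<le> X\<close> and the positive exponents.\<close>
  have sum: "u + v \<le> u * v" if "2 \<le> u" "2 \<le> v" for u v :: nat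
  proof -
    obtain u' v' where "u = u' + 2" "v = v' + 2"
      using \<open>2 \<le> u\<close> \<open>2 \<le> v\<close> by (metis add.commute le_Suc_ex)
    then show ?thesis by (simp add: algebra_simps)
  qed
  have le: "X ^ p + X ^ q \<le> X ^ (p + q)" using sum[OF p] by (simp add: power_add)
  show ?thesis
  proof (cases f)
    case TimesOp
    then show ?thesis using assms by (simp add: power_add mult_le_mono)
  qed (use assms le p in \<open>auto simp: of_bool_def\<close>)
qed

lemma eval_le:
  assumes "wf_exp m a" "0 < m" "\<And>q. q < m \<Longrightarrow> s q \<le> X" "2 \<le> X" "max_const a \<le> X" "\<And>w. w \<in> set x \<Longrightarrow> w \<le> X"
  shows "eval x a s \<le> X ^ growth a"
  using assms
proof (induction a arbitrary: m s)
  case (Op f a b)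
  have "eval x a s \<le> X ^ growth a" "eval x b s \<le> X ^ growth b"
    using Op.prems by (auto intro!: Op.IH[of m])
  then show ?case using apply_op_le Op.prems growth_pos by (simp add: Suc_le_eq)
next
  case (Rd a)
  have "X \<le> X ^ growth (Rd a)" using Rd.prems by (simp add: self_le_power)
  moreover have "eval x (Rd a) s \<le> X" using Rd.prems by auto
  ultimately show ?case by linarith
next
  case (Sum v a)
  have "eval x a (s(v := j)) \<le> X ^ growth a" if "j < s 0" for j
  proof (rule Sum.IH[of "Suc m"])
    show "(s(v := j)) q \<le> X" if "q < Suc m" for q
      using that Sum.prems \<open>j < s 0\<close> by (auto simp: less_Suc_eq intro: order_trans less_imp_le)
  qed (use Sum.prems in auto)
  then have "(\<Sum>j<s 0. eval x a (s(v := j))) \<le> s 0 * X ^ growth a"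
    using sum_bounded_above[of "{..<s 0}" "\<lambda>j. eval x a (s(v := j))" "X ^ growth a"] by simp
  also have "\<dots> \<le> X * X ^ growth a" using Sum.prems by simp
  finally show ?case by simp
qed auto

text \<open>Space is charged on the registers of the whole program, which is not known while a
  fragment is analysed; hence the quantification over all finite register sets. \<open>T\<close> is
  only an upper bound on the time, so branches of unequal length can be merged.\<close>

definition runs :: "nat list \<Rightarrow> nat \<Rightarrow> prog \<Rightarrow> store \<Rightarrow> nat list \<Rightarrow> nat \<Rightarrow> store \<Rightarrow> bool" where
  "runs x B c s ys T s' \<longleftrightarrow> (\<forall>r. s r \<le> B) \<and> (\<forall>r. s' r \<le> B) \<and>
     (\<forall>R. finite R \<longrightarrow> (\<exists>t b. run x R c s ys t b s' \<and> t \<le> T \<and> b \<le> card R * nbits B))"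

lemma nbits_mono: "a \<le> b \<Longrightarrow> nbits a \<le> nbits b"
  by (simp add: nbits_def floor_log_le_iff)

lemma mem_bits_le: "(\<And>r. s r \<le> B) \<Longrightarrow> mem_bits R s \<le> card R * nbits B"
  unfolding mem_bits_def by (metis sum_bounded_above nbits_mono of_nat_id)

lemma runs_bounded:
  assumes "runs x B c s ys T s'"
  shows "s r \<le> B" "s' r \<le> B"
  using assms unfolding runs_def by simp_all

lemma runsE:
  assumes "runs x B c s ys T s'" "finite R"
  obtains t b where "run x R c s ys t b s'" "t \<le> T" "b \<le> card R * nbits B"
proof -
  have "\<exists>t b. run x R c s ys t b s' \<and> t \<le> T \<and> b \<le> card R * nbits B"
    using assms unfolding runs_def by simp
  with that show ?thesis by blast
qed

lemma runsI:
  assumes "\<And>r. s r \<le> B" "\<And>r. s' r \<le> B"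
    and "\<And>R. finite R \<Longrightarrow> \<exists>t b. run x R c s ys t b s' \<and> t \<le> T \<and> b \<le> card R * nbits B"
  shows "runs x B c s ys T s'"
  unfolding runs_def using assms by simp

lemma runs_weaken:
  assumes "runs x B c s ys T s'" "T \<le> T'"
  shows "runs x B c s ys T' s'"
proof (rule runsI)
  fix R :: "reg set" assume "finite R"
  from runsE[OF assms(1) this] assms(2)
  show "\<exists>t b. run x R c s ys t b s' \<and> t \<le> T' \<and> b \<le> card R * nbits B"
    by (metis order_trans)
qed (simp_all add: runs_bounded[OF assms(1)])

lemma runs_Skip:
  assumes "\<And>r. s r \<le> B"
  shows "runs x B Skip s [] 1 s"
proof (rule runsI)
  fix R :: "reg set"
  show "\<exists>t b. run x R Skip s [] t b s \<and> t \<le> 1 \<and> b \<le> card R * nbits B"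
    by (intro exI conjI, rule run.Skip) (simp_all add: mem_bits_le[OF assms])
qed (simp_all add: assms)

lemma runs_Do:
  assumes "\<And>r. s r \<le> B" "s' = exec_instr x i s" "\<And>r. s' r \<le> B" "ys = emitted i s"
  shows "runs x B (Do i) s ys 1 s'"
proof (rule runsI)
  fix R :: "reg set"
  show "\<exists>t b. run x R (Do i) s ys t b s' \<and> t \<le> 1 \<and> b \<le> card R * nbits B"
    unfolding assms(4)
    by (intro exI conjI, rule run.Do[OF assms(2)])
      (simp_all add: mem_bits_le[OF assms(1)] mem_bits_le[OF assms(3)])
qed (simp_all add: assms(1,3))

lemma runs_Seq:
  assumes "runs x B c1 s ys1 T1 s1" "runs x B c2 s1 ys2 T2 s2"
  shows "runs x B (Seq c1 c2) s (ys1 @ ys2) (T1 + T2) s2"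
proof (rule runsI)
  fix R :: "reg set" assume R: "finite R"
  obtain t1 b1 where 1: "run x R c1 s ys1 t1 b1 s1" "t1 \<le> T1" "b1 \<le> card R * nbits B"
    by (rule runsE[OF assms(1) R])
  obtain t2 b2 where 2: "run x R c2 s1 ys2 t2 b2 s2" "t2 \<le> T2" "b2 \<le> card R * nbits B"
    by (rule runsE[OF assms(2) R])
  show "\<exists>t b. run x R (Seq c1 c2) s (ys1 @ ys2) t b s2 \<and> t \<le> T1 + T2 \<and> b \<le> card R * nbits B"
    by (intro exI conjI, rule run.Seq[OF 1(1) 2(1)]) (use 1 2 in simp_all)
qed (simp_all add: runs_bounded[OF assms(1)] runs_bounded[OF assms(2)])

lemma runs_If:
  assumes "s p < s q \<Longrightarrow> runs x B c1 s ys T s'" "\<not> s p < s q \<Longrightarrow> runs x B c2 s ys T s'"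
  shows "runs x B (IfLess p q c1 c2) s ys (1 + T) s'"
proof (cases "s p < s q")
  case True
  note R1 = assms(1)[OF True]
  show ?thesis
  proof (rule runsI)
    fix R :: "reg set" assume "finite R"
    then obtain t b where 1: "run x R c1 s ys t b s'" "t \<le> T" "b \<le> card R * nbits B"
      by (rule runsE[OF R1])
    show "\<exists>t b. run x R (IfLess p q c1 c2) s ys t b s' \<and> t \<le> 1 + T \<and> b \<le> card R * nbits B"
      by (intro exI conjI, rule run.IfTrue, rule True, rule 1(1)) (use 1 in simp_all)
  qed (simp_all add: runs_bounded[OF R1])
next
  case False
  note R1 = assms(2)[OF False]
  show ?thesis
  proof (rule runsI)
    fix R :: "reg set" assume "finite R"
    then obtain t b where 1: "run x R c2 s ys t b s'" "t \<le> T" "b \<le> card R * nbits B"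
      by (rule runsE[OF R1])
    show "\<exists>t b. run x R (IfLess p q c1 c2) s ys t b s' \<and> t \<le> 1 + T \<and> b \<le> card R * nbits B"
      by (intro exI conjI, rule run.IfFalse, rule False, rule 1(1)) (use 1 in simp_all)
  qed (simp_all add: runs_bounded[OF R1])
qed

lemma runs_WhileFalse:
  assumes "\<not> s p < s q" "\<And>r. s r \<le> B"
  shows "runs x B (WhileLess p q c) s [] 1 s"
proof (rule runsI)
  fix R :: "reg set"
  show "\<exists>t b. run x R (WhileLess p q c) s [] t b s \<and> t \<le> 1 \<and> b \<le> card R * nbits B"
    by (intro exI conjI, rule run.WhileFalse, rule assms(1)) (simp_all add: mem_bits_le[OF assms(2)])
qed (simp_all add: assms)

lemma runs_WhileTrue:
  assumes "s p < s q" "runs x B c s ys1 T1 s1" "runs x B (WhileLess p q c) s1 ys2 T2 s2"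
  shows "runs x B (WhileLess p q c) s (ys1 @ ys2) (1 + T1 + T2) s2"
proof (rule runsI)
  fix R :: "reg set" assume R: "finite R"
  obtain t1 b1 where 1: "run x R c s ys1 t1 b1 s1" "t1 \<le> T1" "b1 \<le> card R * nbits B"
    by (rule runsE[OF assms(2) R])
  obtain t2 b2 where 2: "run x R (WhileLess p q c) s1 ys2 t2 b2 s2" "t2 \<le> T2" "b2 \<le> card R * nbits B"
    by (rule runsE[OF assms(3) R])
  show "\<exists>t b. run x R (WhileLess p q c) s (ys1 @ ys2) t b s2 \<and> t \<le> 1 + T1 + T2 \<and> b \<le> card R * nbits B"
    by (intro exI conjI, rule run.WhileTrue, rule assms(1), rule 1(1), rule 2(1)) (use 1 2 in simp_all)
qed (simp_all add: runs_bounded[OF assms(2)] runs_bounded[OF assms(3)])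

text \<open>Each round costs its body and one test, and the failing last test gives the additional
  1. The invariant also pins the limit register \<open>w\<close>, which the body must not
  move.\<close>

lemma runs_count:
  assumes step: "\<And>j s. j < n \<Longrightarrow> I j s \<Longrightarrow> \<exists>s'. runs x B c s (ys j) T s' \<and> I (Suc j) s'"
    and inv: "\<And>j s. I j s \<Longrightarrow> s v = j \<and> s w = n \<and> (\<forall>r. s r \<le> B)"
    and "I i s" "i \<le> n"
  shows "\<exists>s'. runs x B (WhileLess v w c) s (concat (map ys [i..<n])) (1 + (n - i) * (T + 1)) s' \<and> I n s'"
  using assms(3,4)
proof (induction "n - i" arbitrary: i s)
  case 0
  then show ?case using inv[of i s] runs_WhileFalse[of s v w B x c] by auto
next
  case (Suc q)
  then have less: "i < n" "q = n - Suc i" by auto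
  obtain s1 where s1: "runs x B c s (ys i) T s1" "I (Suc i) s1"
    using step[OF less(1) Suc.prems(1)] by blast
  obtain s' where s': "runs x B (WhileLess v w c) s1 (concat (map ys [Suc i..<n]))
      (1 + (n - Suc i) * (T + 1)) s'" "I n s'"
    using Suc.hyps(1)[OF less(2) s1(2)] less by auto
  have "s v < s w" using inv[OF Suc.prems(1)] less by simp
  from runs_WhileTrue[OF this s1(1) s'(1)]
  have "runs x B (WhileLess v w c) s (ys i @ concat (map ys [Suc i..<n]))
      (1 + T + (1 + (n - Suc i) * (T + 1))) s'" .
  moreover have "ys i @ concat (map ys [Suc i..<n]) = concat (map ys [i..<n])"
    using less by (simp add: upt_conv_Cons)
  moreover have "1 + T + (1 + (n - Suc i) * (T + 1)) = 1 + (n - i) * (T + 1)"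
    using less by (metis Suc.hyps(2) add.assoc add.commute add.left_commute mult_Suc)
  ultimately show ?case using s'(2) by auto
qed

lemma runs_comp_op:
  assumes "\<And>q. s q \<le> B" "apply_op f (s r) (s (Suc r)) \<le> B" "1 \<le> B"
  shows "runs x B (comp_op f r) s [] 2 (s(r := apply_op f (s r) (s (Suc r))))"
proof (cases f)
  case PlusOp
  have "runs x B (comp_op f r) s [] 1 (s(r := apply_op f (s r) (s (Suc r))))"
    unfolding PlusOp comp_op.simps
    by (rule runs_Do) (use assms PlusOp in auto)
  then show ?thesis by (rule runs_weaken) simp
next
  case MinusOp
  have "runs x B (comp_op f r) s [] 1 (s(r := apply_op f (s r) (s (Suc r))))"
    unfolding MinusOp comp_op.simps
    by (rule runs_Do) (use assms MinusOp in auto)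
  then show ?thesis by (rule runs_weaken) simp
next
  case TimesOp
  have "runs x B (comp_op f r) s [] 1 (s(r := apply_op f (s r) (s (Suc r))))"
    unfolding TimesOp comp_op.simps
    by (rule runs_Do) (use assms TimesOp in auto)
  then show ?thesis by (rule runs_weaken) simp
next
  case LessOp
  have "runs x B (comp_op f r) s [] (1 + 1) (s(r := apply_op f (s r) (s (Suc r))))"
    unfolding LessOp comp_op.simps
    by (rule runs_If; rule runs_Do) (use assms LessOp in auto)
  then show ?thesis by (simp only: one_add_one)
qed

text \<open>Two bounds are kept apart: \<open>X\<close> for what the expression can read (variables
  below \<open>m\<close>, constants, input entries) and \<open>B\<close> for all registers, which
  may contain stale intermediate results. The frame condition exempts bound variables; by their
  numbering these are at least \<open>m\<close>, so the variables that a sibling reads stay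
  intact.\<close>

lemma runs_comp_exp:
  assumes "wf_exp m a" "0 < m" "m \<le> r" "\<And>v. v \<in> bound_vars a \<Longrightarrow> v < r"
    "\<And>q. q < m \<Longrightarrow> s q \<le> X" "2 \<le> X" "max_const a \<le> X" "\<And>w. w \<in> set x \<Longrightarrow> w \<le> X"
    "X ^ growth a \<le> B" "\<And>q. s q \<le> B"
  shows "\<exists>s'. runs x B (comp_exp r a) s [] (cost a * Suc (s 0) ^ depth a) s' \<and>
    s' r = eval x a s \<and> (\<forall>q<r. q \<notin> bound_vars a \<longrightarrow> s' q = s q)"
  using assms
proof (induction a arbitrary: m r s)
  case (V v)
  have "runs x B (comp_exp r (V v)) s ([] @ []) (1 + 1) (s(r := s v))"
    unfolding comp_exp.simps
    by (rule runs_Seq[OF runs_Do[where s' = "s(r := 0)"] runs_Do]) (use V.prems in auto)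
  then have R: "runs x B (comp_exp r (V v)) s [] (cost (V v) * Suc (s 0) ^ depth (V v)) (s(r := s v))"
    by (simp only: append_Nil one_add_one cost.simps depth.simps power_0 mult_1_right)
  show ?case by (rule exI, rule conjI, rule R) auto
next
  case (N c)
  have "c \<le> X" "X \<le> B" using N.prems by auto
  then have "c \<le> B" by (rule order_trans)
  then have "runs x B (comp_exp r (N c)) s [] 1 (s(r := c))"
    unfolding comp_exp.simps
    by (intro runs_Do) (use N.prems in auto)
  then have R: "runs x B (comp_exp r (N c)) s [] (cost (N c) * Suc (s 0) ^ depth (N c)) (s(r := c))"
    by simp
  show ?case by (rule exI, rule conjI, rule R) auto
next
  case (Op f a b)
  have le: "X ^ growth a \<le> B" "X ^ growth b \<le> B"
    by (rule order_trans[OF power_increasing Op.prems(9)]; use Op.prems(6) in simp)+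
  obtain s1 where s1: "runs x B (comp_exp r a) s [] (cost a * Suc (s 0) ^ depth a) s1"
      "s1 r = eval x a s" "\<forall>q<r. q \<notin> bound_vars a \<longrightarrow> s1 q = s q"
    using Op.IH(1)[of m r s] Op.prems le by auto
  have same: "s1 q = s q" if "q < m" for q
    using s1(3) that Op.prems wf_exp_bound_vars[of m a q] by (meson less_le_trans not_less wf_exp.simps(3))
  have B1: "s1 q \<le> B" for q using s1(1) by (simp add: runs_def)
  obtain s2 where s2: "runs x B (comp_exp (Suc r) b) s1 [] (cost b * Suc (s1 0) ^ depth b) s2"
      "s2 (Suc r) = eval x b s1" "\<forall>q<Suc r. q \<notin> bound_vars b \<longrightarrow> s2 q = s1 q"
    using Op.IH(2)[of m "Suc r" s1] Op.prems le B1 same by (auto simp: less_Suc_eq)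
  have B2: "s2 q \<le> B" for q using s2(1) by (simp add: runs_def)
  \<comment> \<open>The first operand waits in \<open>r\<close> while \<open>b\<close> is evaluated
    from \<open>Suc r\<close> upwards; the loop variables of \<open>b\<close> lie below
    \<open>r\<close> and cannot hit it.\<close>
  have "r \<notin> bound_vars b" using Op.prems(4)[of r] by auto
  then have ev: "s2 r = eval x a s" "s2 (Suc r) = eval x b s"
    using s1(2) s2(2,3) eval_cong[of m b s1 s x] same Op.prems(1,2) by simp_all
  have "eval x (Op f a b) s \<le> X ^ growth (Op f a b)"
    by (rule eval_le) (use Op.prems in auto)
  then have evB: "apply_op f (s2 r) (s2 (Suc r)) \<le> B" using ev Op.prems(9) by simp
  have "1 \<le> B" using Op.prems(9,6) by (metis One_nat_def Suc_1 Suc_leI le_trans less_le_trans one_le_power zero_less_Suc less_imp_le_nat)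
  from runs_Seq[OF s1(1) runs_Seq[OF s2(1) runs_comp_op[OF B2 evB this]]]
  have "runs x B (comp_exp r (Op f a b)) s [] (cost a * Suc (s 0) ^ depth a + (cost b * Suc (s1 0) ^ depth b + 2))
     (s2(r := apply_op f (s2 r) (s2 (Suc r))))" by simp
  moreover have "cost a * Suc (s 0) ^ depth a + (cost b * Suc (s1 0) ^ depth b + 2)
     \<le> cost (Op f a b) * Suc (s 0) ^ depth (Op f a b)"
  proof -
    let ?P = "Suc (s 0) ^ depth (Op f a b)"
    have "s1 0 = s 0" using same Op.prems by simp
    moreover have "cost a * Suc (s 0) ^ depth a \<le> cost a * ?P"
      "cost b * Suc (s 0) ^ depth b \<le> cost b * ?P" "2 \<le> 2 * ?P"
      by (auto intro!: mult_le_mono2 power_increasing)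
    ultimately have "cost a * Suc (s 0) ^ depth a + (cost b * Suc (s1 0) ^ depth b + 2)
       \<le> cost a * ?P + (cost b * ?P + 2 * ?P)"
      by (intro add_mono) simp_all
    also have "\<dots> = cost (Op f a b) * ?P"
      by (simp only: cost.simps distrib_right add.assoc)
    finally show ?thesis .
  qed
  ultimately have R: "runs x B (comp_exp r (Op f a b)) s [] (cost (Op f a b) * Suc (s 0) ^ depth (Op f a b))
     (s2(r := apply_op f (s2 r) (s2 (Suc r))))" by (rule runs_weaken)
  show ?case by (rule exI, rule conjI, rule R) (use s1(3) s2(3) ev in simp)
next
  case (Rd a)
  have "X ^ growth a \<le> B" "X \<le> B"
    using order_trans[OF power_increasing[of "growth a" "growth (Rd a)" X] Rd.prems(9)]
      order_trans[OF self_le_power[of X "growth (Rd a)"] Rd.prems(9)] Rd.prems(6) by simp_all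
  then obtain s1 where s1: "runs x B (comp_exp r a) s [] (cost a * Suc (s 0) ^ depth a) s1"
      "s1 r = eval x a s" "\<forall>q<r. q \<notin> bound_vars a \<longrightarrow> s1 q = s q"
    using Rd.IH[of m r s] Rd.prems by auto
  have B1: "s1 q \<le> B" for q using s1(1) by (simp add: runs_def)
  have "eval x (Rd a) s \<le> X" by (simp add: Rd.prems(8))
  then have ev: "eval x (Rd a) s \<le> B" using \<open>X \<le> B\<close> by (rule order_trans)
  have "runs x B (Do (Read r r)) s1 [] 1 (s1(r := eval x (Rd a) s))"
    by (rule runs_Do) (use B1 s1(2) ev in auto)
  from runs_Seq[OF s1(1) this]
  have "runs x B (comp_exp r (Rd a)) s [] (cost a * Suc (s 0) ^ depth a + 1) (s1(r := eval x (Rd a) s))"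
    by simp
  moreover have "cost a * Suc (s 0) ^ depth a + 1 \<le> cost (Rd a) * Suc (s 0) ^ depth (Rd a)"
    by simp
  ultimately have R: "runs x B (comp_exp r (Rd a)) s [] (cost (Rd a) * Suc (s 0) ^ depth (Rd a))
     (s1(r := eval x (Rd a) s))" by (rule runs_weaken)
  show ?case by (rule exI, rule conjI, rule R) (use s1 in auto)
next
  case (Sum v a)
  let ?n = "s 0"
  let ?s0 = "s(r := 0, v := 0)"
  let ?T = "cost a * Suc ?n ^ depth a + 3"
  define f where "f j = eval x a (s(v := j))" for j
  define I where "I j s' \<longleftrightarrow> s' v = j \<and> s' r = (\<Sum>i<j. f i) \<and> (\<forall>q. s' q \<le> B) \<and>
    (\<forall>q<r. q \<notin> bound_vars (Sum v a) \<longrightarrow> s' q = s q)" for j s'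
  have v: "v = m" "v < r" "0 < v" "wf_exp (Suc v) a" using Sum.prems by auto
  have nbv: "q \<notin> bound_vars a" if "q \<le> v" for q
    using wf_exp_bound_vars[OF v(4), of q] that by auto
  have le: "X ^ growth a \<le> B" "X \<le> B"
    using order_trans[OF power_increasing[of "growth a" "growth (Sum v a)" X] Sum.prems(9)]
      order_trans[OF self_le_power[of X "growth (Sum v a)"] Sum.prems(9)] Sum.prems(6) by simp_all
  have nX: "?n \<le> X" using Sum.prems by auto
  \<comment> \<open>\<open>eval_le\<close> speaks of the completed sum only; the partial sums
    accumulated in \<open>r\<close> are dominated by it.\<close>
  have evle: "(\<Sum>i<j. f i) \<le> B" if "j \<le> ?n" for j
  proof -
    have "(\<Sum>i<j. f i) \<le> (\<Sum>i<?n. f i)" using that by (intro sum_mono2) auto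
    also have "\<dots> = eval x (Sum v a) s" by (simp add: f_def)
    also have "\<dots> \<le> X ^ growth (Sum v a)"
      by (rule eval_le) (use Sum.prems in auto)
    finally show ?thesis using Sum.prems(9) by linarith
  qed
  have step: "\<exists>s''. runs x B (Seq (comp_exp (Suc r) a) (Seq (Do (Add r r (Suc r)))
       (Seq (Do (Const (Suc r) 1)) (Do (Add v v (Suc r)))))) s' [] ?T s'' \<and> I (Suc j) s''"
    if "j < ?n" "I j s'" for j s'
  proof -
    have s': "s' v = j" "s' r = (\<Sum>i<j. f i)" "\<And>q. s' q \<le> B"
      "\<And>q. q < r \<Longrightarrow> q \<notin> bound_vars (Sum v a) \<Longrightarrow> s' q = s q"
      using that(2) by (auto simp: I_def)
    have same: "s' q = (s(v := j)) q" if "q < Suc v" for q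
      using s' nbv that v by auto
    have s'0: "s' 0 = ?n" using same[of 0] v by simp
    have "\<forall>q<Suc v. s' q \<le> X"
      using same Sum.prems(5) v less_le_trans[OF \<open>j < ?n\<close> nX] by (auto simp: less_Suc_eq)
    then obtain s1 where s1: "runs x B (comp_exp (Suc r) a) s' [] (cost a * Suc ?n ^ depth a) s1"
      "s1 (Suc r) = eval x a s'" "\<forall>q<Suc r. q \<notin> bound_vars a \<longrightarrow> s1 q = s' q"
      using Sum.IH[of "Suc v" "Suc r" s'] Sum.prems v le s' s'0 by (auto simp: less_Suc_eq)
    have B1: "s1 q \<le> B" for q using s1(1) by (simp add: runs_def)
    have ev: "s1 (Suc r) = f j" unfolding s1 f_def
      by (rule eval_cong[OF v(4)]) (use same in auto)
    have rn: "r \<notin> bound_vars a" using Sum.prems by auto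
    have s1r: "s1 r = (\<Sum>i<j. f i)" using s1 s' rn by auto
    have s1v: "s1 v = j" using s1 nbv[of v] v s' by auto
    let ?s2 = "s1(r := \<Sum>i<Suc j. f i)"
    let ?s3 = "?s2(Suc r := 1)"
    let ?s4 = "?s3(v := Suc j)"
    have sj: "(\<Sum>i<Suc j. f i) \<le> B" using evle[of "Suc j"] that by simp
    have "Suc j \<le> B" using that nX le by linarith
    have "v \<noteq> Suc r" using v by simp
    have "runs x B (Do (Add r r (Suc r))) s1 [] 1 ?s2"
      by (rule runs_Do) (use B1 s1r ev sj in auto)
    moreover have "runs x B (Do (Const (Suc r) 1)) ?s2 [] 1 ?s3"
      by (rule runs_Do) (use B1 sj le Sum.prems in auto)
    moreover have "runs x B (Do (Add v v (Suc r))) ?s3 [] 1 ?s4"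
      by (rule runs_Do) (use B1 sj le Sum.prems s1v v \<open>v \<noteq> Suc r\<close> \<open>Suc j \<le> B\<close> in \<open>auto simp: fun_eq_iff\<close>)
    ultimately have "runs x B (Seq (comp_exp (Suc r) a) (Seq (Do (Add r r (Suc r)))
       (Seq (Do (Const (Suc r) 1)) (Do (Add v v (Suc r)))))) s' ([] @ [] @ [] @ [])
        (cost a * Suc ?n ^ depth a + (1 + (1 + 1))) ?s4"
      by (intro runs_Seq[OF s1(1)] runs_Seq) 
    then have R: "runs x B (Seq (comp_exp (Suc r) a) (Seq (Do (Add r r (Suc r)))
       (Seq (Do (Const (Suc r) 1)) (Do (Add v v (Suc r)))))) s' [] ?T ?s4"
      by (simp add: numeral_3_eq_3)
    moreover have "I (Suc j) ?s4"
      unfolding I_def using R s1 s' v by (auto simp: runs_def)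
    ultimately show ?thesis by blast
  qed
  have I0: "I 0 ?s0" using Sum.prems(10) v by (auto simp: I_def)
  have "\<exists>s'. runs x B (WhileLess v 0 (Seq (comp_exp (Suc r) a) (Seq (Do (Add r r (Suc r)))
       (Seq (Do (Const (Suc r) 1)) (Do (Add v v (Suc r))))))) ?s0 (concat (map (\<lambda>_. []) [0..<?n]))
       (1 + (?n - 0) * (?T + 1)) s' \<and> I ?n s'"
    by (rule runs_count[where I = I])
      (use step I0 nbv v in \<open>auto simp: I_def\<close>)
  then obtain s' where s': "runs x B (WhileLess v 0 (Seq (comp_exp (Suc r) a) (Seq (Do (Add r r (Suc r)))
       (Seq (Do (Const (Suc r) 1)) (Do (Add v v (Suc r))))))) ?s0 []
       (1 + ?n * (?T + 1)) s'" "I ?n s'" by (auto simp: concat_replicate_trivial map_replicate_const)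
  have R1: "runs x B (Do (Const r 0)) s [] 1 (s(r := 0))"
    by (rule runs_Do) (use Sum.prems(10) in auto)
  have R2: "runs x B (Do (Const v 0)) (s(r := 0)) [] 1 ?s0"
    by (rule runs_Do) (use Sum.prems(10) in auto)
  have "runs x B (comp_exp r (Sum v a)) s ([] @ [] @ []) (1 + (1 + (1 + ?n * (?T + 1)))) s'"
    unfolding comp_exp.simps by (rule runs_Seq[OF R1 runs_Seq[OF R2 s'(1)]])
  \<comment> \<open>With base \<open>Suc ?n\<close> instead of \<open>?n\<close>, the extra unit
    pays for the two initialisations and the failing test, even when \<open>?n\<close> is 0.\<close>
  moreover have "1 + (1 + (1 + ?n * (?T + 1))) \<le> cost (Sum v a) * Suc ?n ^ depth (Sum v a)"
  proof -
    have "1 \<le> Suc ?n ^ depth a" by simp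
    then have "Suc ?n \<le> Suc ?n * Suc ?n ^ depth a" by (metis mult.right_neutral mult_le_mono2)
    moreover have "?n * (cost a * Suc ?n ^ depth a) \<le> Suc ?n * (cost a * Suc ?n ^ depth a)" by simp
    moreover have "cost (Sum v a) * Suc ?n ^ depth (Sum v a) =
      Suc ?n * (cost a * Suc ?n ^ depth a) + 4 * (Suc ?n * Suc ?n ^ depth a)"
      by (simp add: algebra_simps)
    moreover have "1 + (1 + (1 + ?n * (?T + 1))) = 3 + ?n * (cost a * Suc ?n ^ depth a) + 4 * ?n"
      by (simp add: algebra_simps)
    ultimately show ?thesis by linarith
  qed
  ultimately have R: "runs x B (comp_exp r (Sum v a)) s [] (cost (Sum v a) * Suc ?n ^ depth (Sum v a)) s'"
    unfolding append_Nil by (rule runs_weaken)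
  show ?case by (rule exI, rule conjI, rule R) (use s'(2) in \<open>auto simp: I_def f_def\<close>)
qed

section \<open>Statements that produce output\<close>

datatype stm = Wr exp | Sq stm stm | If exp stm | For nat stm

text \<open>There is no assignment; only \<open>For\<close> alters the store, and only for its body.
  So both parts of \<open>Sq\<close> are read in the same store and the output has a closed
  form.\<close>

primrec out :: "nat list \<Rightarrow> stm \<Rightarrow> store \<Rightarrow> nat list" where
  "out x (Wr a) s = [eval x a s]"
| "out x (Sq c d) s = out x c s @ out x d s"
| "out x (If a c) s = (if 0 < eval x a s then out x c s else [])"
| "out x (For v c) s = concat (map (\<lambda>j. out x c (s(v := j))) [0..<s 0])"

primrec wf_stm :: "nat \<Rightarrow> stm \<Rightarrow> bool" where
  "wf_stm m (Wr a) \<longleftrightarrow> wf_exp m a"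
| "wf_stm m (Sq c d) \<longleftrightarrow> wf_stm m c \<and> wf_stm m d"
| "wf_stm m (If a c) \<longleftrightarrow> wf_exp m a \<and> wf_stm m c"
| "wf_stm m (For v c) \<longleftrightarrow> v = m \<and> wf_stm (Suc m) c"

primrec stm_vars :: "stm \<Rightarrow> nat set" where
  "stm_vars (Wr a) = bound_vars a"
| "stm_vars (Sq c d) = stm_vars c \<union> stm_vars d"
| "stm_vars (If a c) = bound_vars a \<union> stm_vars c"
| "stm_vars (For v c) = insert v (stm_vars c)"

primrec stm_depth :: "stm \<Rightarrow> nat" where
  "stm_depth (Wr a) = depth a"
| "stm_depth (Sq c d) = max (stm_depth c) (stm_depth d)"
| "stm_depth (If a c) = max (depth a) (stm_depth c)"
| "stm_depth (For v c) = Suc (stm_depth c)"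

primrec stm_cost :: "stm \<Rightarrow> nat" where
  "stm_cost (Wr a) = cost a + 1"
| "stm_cost (Sq c d) = stm_cost c + stm_cost d"
| "stm_cost (If a c) = cost a + stm_cost c + 3"
| "stm_cost (For v c) = stm_cost c + 4"

primrec stm_const :: "stm \<Rightarrow> nat" where
  "stm_const (Wr a) = max_const a"
| "stm_const (Sq c d) = max (stm_const c) (stm_const d)"
| "stm_const (If a c) = max (max_const a) (stm_const c)"
| "stm_const (For v c) = stm_const c"

text \<open>Only maxima occur, in contrast to \<open>growth\<close>: sequences and loops concatenate
  outputs and never combine values arithmetically.\<close>

primrec stm_growth :: "stm \<Rightarrow> nat" where
  "stm_growth (Wr a) = growth a"
| "stm_growth (Sq c d) = max (stm_growth c) (stm_growth d)"
| "stm_growth (If a c) = max (growth a) (stm_growth c)"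
| "stm_growth (For v c) = stm_growth c"

primrec comp_stm :: "reg \<Rightarrow> stm \<Rightarrow> prog" where
  "comp_stm r (Wr a) = Seq (comp_exp r a) (Do (Write r))"
| "comp_stm r (Sq c d) = Seq (comp_stm r c) (comp_stm r d)"
| "comp_stm r (If a c) = Seq (comp_exp r a) (Seq (Do (Const (Suc r) 0))
     (IfLess (Suc r) r (comp_stm r c) Skip))"
| "comp_stm r (For v c) = Seq (Do (Const v 0))
     (WhileLess v 0 (Seq (comp_stm r c) (Seq (Do (Const r 1)) (Do (Add v v r)))))"

lemma wf_stm_vars: "wf_stm m c \<Longrightarrow> v \<in> stm_vars c \<Longrightarrow> m \<le> v"
  by (induction c arbitrary: m) (fastforce dest: wf_exp_bound_vars)+

lemma finite_stm_vars: "finite (stm_vars c)"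
  by (induction c) (auto simp: finite_bound_vars)

lemma stm_growth_pos: "0 < stm_growth c"
  by (induction c) (auto simp: growth_pos le_max_iff_disj)

lemma out_cong: "wf_stm m c \<Longrightarrow> 0 < m \<Longrightarrow> (\<And>q. q < m \<Longrightarrow> s q = s' q) \<Longrightarrow> out x c s = out x c s'"
proof (induction c arbitrary: m s s')
  case (For v c)
  have "out x c (s(v := j)) = out x c (s'(v := j))" for j
    by (rule For.IH[of "Suc m"]) (use For.prems in auto)
  then show ?case using For.prems by simp
next
  case (Sq c d)
  have "out x c s = out x c s'" "out x d s = out x d s'"
    using Sq.prems by (auto intro!: Sq.IH[of m])
  then show ?case by simp
next
  case (If a c)
  have "eval x a s = eval x a s'" "out x c s = out x c s'"
    using If.prems by (auto intro!: If.IH[of m] eval_cong[of m])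
  then show ?case by simp
next
  case (Wr a)
  then show ?case using eval_cong[of m a s s'] by simp
qed

lemma runs_comp_stm:
  assumes "wf_stm m c" "0 < m" "m \<le> r" "\<And>v. v \<in> stm_vars c \<Longrightarrow> v < r"
    "\<And>q. q < m \<Longrightarrow> s q \<le> X" "2 \<le> X" "stm_const c \<le> X" "\<And>w. w \<in> set x \<Longrightarrow> w \<le> X"
    "X ^ stm_growth c \<le> B" "\<And>q. s q \<le> B"
  shows "\<exists>s'. runs x B (comp_stm r c) s (out x c s) (stm_cost c * Suc (s 0) ^ stm_depth c) s' \<and>
    (\<forall>q<r. q \<notin> stm_vars c \<longrightarrow> s' q = s q)"
  using assms
proof (induction c arbitrary: m r s)
  case (Wr a)
  obtain s1 where s1: "runs x B (comp_exp r a) s [] (cost a * Suc (s 0) ^ depth a) s1"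
      "s1 r = eval x a s" "\<forall>q<r. q \<notin> bound_vars a \<longrightarrow> s1 q = s q"
    using runs_comp_exp[of m a r s X x B] Wr.prems by auto
  have "runs x B (Do (Write r)) s1 [eval x a s] 1 s1"
    by (rule runs_Do) (use runs_bounded[OF s1(1)] s1(2) in auto)
  from runs_Seq[OF s1(1) this]
  have "runs x B (comp_stm r (Wr a)) s (out x (Wr a) s) (cost a * Suc (s 0) ^ depth a + 1) s1" by simp
  then have R: "runs x B (comp_stm r (Wr a)) s (out x (Wr a) s)
      (stm_cost (Wr a) * Suc (s 0) ^ stm_depth (Wr a)) s1"
    by (rule runs_weaken) simp
  show ?case by (rule exI, rule conjI, rule R) (use s1 in auto)
next
  case (Sq c d)
  have le: "X ^ stm_growth c \<le> B" "X ^ stm_growth d \<le> B"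
    by (rule order_trans[OF power_increasing Sq.prems(9)]; use Sq.prems(6) in simp)+
  obtain s1 where s1: "runs x B (comp_stm r c) s (out x c s) (stm_cost c * Suc (s 0) ^ stm_depth c) s1"
      "\<forall>q<r. q \<notin> stm_vars c \<longrightarrow> s1 q = s q"
    using Sq.IH(1)[of m r s] Sq.prems le by auto
  have same: "s1 q = s q" if "q < m" for q
    using s1(2) that Sq.prems wf_stm_vars[of m c q] by (meson less_le_trans not_less wf_stm.simps(2))
  have B1: "s1 q \<le> B" for q using s1(1) by (rule runs_bounded)
  obtain s2 where s2: "runs x B (comp_stm r d) s1 (out x d s1) (stm_cost d * Suc (s1 0) ^ stm_depth d) s2"
      "\<forall>q<r. q \<notin> stm_vars d \<longrightarrow> s2 q = s1 q"
    using Sq.IH(2)[of m r s1] Sq.prems le B1 same by auto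
  have o: "out x d s1 = out x d s"
    by (rule out_cong[of m]) (use Sq.prems same in auto)
  have "s1 0 = s 0" using same Sq.prems by simp
  from runs_Seq[OF s1(1) s2(1)[unfolded this o]]
  have "runs x B (comp_stm r (Sq c d)) s (out x (Sq c d) s)
     (stm_cost c * Suc (s 0) ^ stm_depth c + stm_cost d * Suc (s 0) ^ stm_depth d) s2" by simp
  then have R: "runs x B (comp_stm r (Sq c d)) s (out x (Sq c d) s)
     (stm_cost (Sq c d) * Suc (s 0) ^ stm_depth (Sq c d)) s2"
  proof (rule runs_weaken)
    show "stm_cost c * Suc (s 0) ^ stm_depth c + stm_cost d * Suc (s 0) ^ stm_depth d
      \<le> stm_cost (Sq c d) * Suc (s 0) ^ stm_depth (Sq c d)"
      unfolding stm_cost.simps distrib_right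
      by (intro add_mono mult_le_mono2 power_increasing) auto
  qed
  show ?case by (rule exI, rule conjI, rule R) (use s1 s2 in auto)
next
  case (If a c)
  let ?D = "stm_depth (If a c)"
  have le: "X ^ growth a \<le> B" "X ^ stm_growth c \<le> B"
    by (rule order_trans[OF power_increasing If.prems(9)]; use If.prems(6) in simp)+
  obtain s1 where s1: "runs x B (comp_exp r a) s [] (cost a * Suc (s 0) ^ depth a) s1"
      "s1 r = eval x a s" "\<forall>q<r. q \<notin> bound_vars a \<longrightarrow> s1 q = s q"
    using runs_comp_exp[of m a r s X x B] If.prems le by auto
  have B1: "s1 q \<le> B" for q using s1(1) by (rule runs_bounded)
  let ?s2 = "s1(Suc r := 0)"
  have same: "?s2 q = s q" if "q < m" for q
  proof -
    have "wf_exp m a" "q < r" using that If.prems by auto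
    then have "q \<notin> bound_vars a" using wf_exp_bound_vars[of m a q] that by auto
    then show ?thesis using s1(3) \<open>q < r\<close> by simp
  qed
  have R2: "runs x B (Do (Const (Suc r) 0)) s1 [] 1 ?s2"
    by (rule runs_Do) (use B1 in auto)
  have "\<exists>s'. runs x B (comp_stm r c) ?s2 (out x c ?s2) (stm_cost c * Suc (?s2 0) ^ stm_depth c) s' \<and>
    (\<forall>q<r. q \<notin> stm_vars c \<longrightarrow> s' q = ?s2 q)"
  proof (rule If.IH[of m r ?s2])
    show "?s2 q \<le> X" if "q < m" for q using same[OF that] If.prems(5)[OF that] by simp
  qed (use If.prems le B1 in auto)
  then obtain s3 where s3: "runs x B (comp_stm r c) ?s2 (out x c ?s2) (stm_cost c * Suc (?s2 0) ^ stm_depth c) s3"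
      "\<forall>q<r. q \<notin> stm_vars c \<longrightarrow> s3 q = ?s2 q"
    by blast
  have o: "out x c ?s2 = out x c s"
    by (rule out_cong[of m]) (use If.prems same in auto)
  have z: "?s2 0 = s 0" using same If.prems by blast
  \<comment> \<open>The two branches end in different stores, whereas \<open>runs_If\<close> expects
    one name for the final store.\<close>
  define s4 where "s4 = (if 0 < eval x a s then s3 else ?s2)"
  have "runs x B (IfLess (Suc r) r (comp_stm r c) Skip) ?s2 (out x (If a c) s)
      (1 + (stm_cost c * Suc (s 0) ^ stm_depth c + 1)) s4"
  proof (rule runs_If)
    assume "?s2 (Suc r) < ?s2 r"
    then have "0 < eval x a s" using s1(2) by simp
    then show "runs x B (comp_stm r c) ?s2 (out x (If a c) s) (stm_cost c * Suc (s 0) ^ stm_depth c + 1) s4"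
      using runs_weaken[OF s3(1)] o z by (simp add: s4_def)
  next
    assume "\<not> ?s2 (Suc r) < ?s2 r"
    then have "\<not> 0 < eval x a s" using s1(2) by simp
    moreover have "runs x B Skip ?s2 [] (stm_cost c * Suc (s 0) ^ stm_depth c + 1) ?s2"
      by (rule runs_weaken[OF runs_Skip]) (use B1 in auto)
    ultimately show "runs x B Skip ?s2 (out x (If a c) s) (stm_cost c * Suc (s 0) ^ stm_depth c + 1) s4"
      by (simp add: s4_def)
  qed
  from runs_Seq[OF s1(1) runs_Seq[OF R2 this]]
  have "runs x B (comp_stm r (If a c)) s (out x (If a c) s)
     (cost a * Suc (s 0) ^ depth a + (1 + (1 + (stm_cost c * Suc (s 0) ^ stm_depth c + 1)))) s4" by simp
  then have R: "runs x B (comp_stm r (If a c)) s (out x (If a c) s)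
     (stm_cost (If a c) * Suc (s 0) ^ ?D) s4"
  proof (rule runs_weaken)
    let ?P = "Suc (s 0) ^ ?D"
    have "cost a * Suc (s 0) ^ depth a \<le> cost a * ?P"
      "stm_cost c * Suc (s 0) ^ stm_depth c \<le> stm_cost c * ?P" "3 \<le> 3 * ?P"
      by (auto intro!: mult_le_mono2 power_increasing)
    then have "(cost a * Suc (s 0) ^ depth a + stm_cost c * Suc (s 0) ^ stm_depth c) + 3
       \<le> (cost a * ?P + stm_cost c * ?P) + 3 * ?P"
      by (intro add_mono) simp_all
    also have "\<dots> = stm_cost (If a c) * ?P"
      by (simp only: stm_cost.simps distrib_right)
    finally show "cost a * Suc (s 0) ^ depth a + (1 + (1 + (stm_cost c * Suc (s 0) ^ stm_depth c + 1)))
      \<le> stm_cost (If a c) * ?P" by linarith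
  qed
  show ?case by (rule exI, rule conjI, rule R) (use s1(3) s3(2) in \<open>auto simp: s4_def\<close>)
next
  case (For v c)
  let ?n = "s 0"
  let ?T = "stm_cost c * Suc ?n ^ stm_depth c + 2"
  let ?body = "Seq (comp_stm r c) (Seq (Do (Const r 1)) (Do (Add v v r)))"
  define I where "I j s' \<longleftrightarrow> s' v = j \<and> (\<forall>q. s' q \<le> B) \<and>
    (\<forall>q<r. q \<notin> stm_vars (For v c) \<longrightarrow> s' q = s q)" for j s'
  have v: "v = m" "v < r" "0 < v" "wf_stm (Suc v) c" using For.prems by auto
  have nbv: "q \<notin> stm_vars c" if "q \<le> v" for q
    using wf_stm_vars[OF v(4), of q] that by auto
  have XB: "X \<le> B"
    using order_trans[OF self_le_power[of X "stm_growth (For v c)"] For.prems(9)] For.prems(6)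
      stm_growth_pos[of c] by simp
  have nX: "?n \<le> X" using For.prems by auto
  have step: "\<exists>s''. runs x B ?body s' (out x c (s(v := j))) ?T s'' \<and> I (Suc j) s''"
    if "j < ?n" "I j s'" for j s'
  proof -
    have s': "s' v = j" "\<And>q. s' q \<le> B"
      "\<And>q. q < r \<Longrightarrow> q \<notin> stm_vars (For v c) \<Longrightarrow> s' q = s q"
      using that(2) by (auto simp: I_def)
    have same: "s' q = (s(v := j)) q" if "q < Suc v" for q
      using s' nbv that v by auto
    have s'0: "s' 0 = ?n" using same[of 0] v by simp
    have "\<forall>q<Suc v. s' q \<le> X"
      using same For.prems(5) v less_le_trans[OF \<open>j < ?n\<close> nX] by (auto simp: less_Suc_eq)
    then obtain s1 where s1: "runs x B (comp_stm r c) s' (out x c s') (stm_cost c * Suc ?n ^ stm_depth c) s1"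
      "\<forall>q<r. q \<notin> stm_vars c \<longrightarrow> s1 q = s' q"
      using For.IH[of "Suc v" r s'] For.prems v s' s'0 by auto
    have B1: "s1 q \<le> B" for q using s1(1) by (rule runs_bounded)
    have o: "out x c s' = out x c (s(v := j))"
      by (rule out_cong[OF v(4)]) (use same in auto)
    have s1v: "s1 v = j" using s1 nbv[of v] v s' by auto
    let ?s3 = "s1(r := 1)"
    let ?s4 = "?s3(v := Suc j)"
    have "Suc j \<le> B" using that nX XB by linarith
    have "runs x B (Do (Const r 1)) s1 [] 1 ?s3"
      by (rule runs_Do) (use B1 XB For.prems in auto)
    moreover have "runs x B (Do (Add v v r)) ?s3 [] 1 ?s4"
      by (rule runs_Do) (use B1 XB For.prems s1v v \<open>Suc j \<le> B\<close> in \<open>auto simp: fun_eq_iff\<close>)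
    ultimately have "runs x B ?body s' (out x c s' @ [] @ [])
        (stm_cost c * Suc ?n ^ stm_depth c + (1 + 1)) ?s4"
      by (intro runs_Seq[OF s1(1)] runs_Seq) 
    then have R: "runs x B ?body s' (out x c (s(v := j))) ?T ?s4"
      by (simp only: append_Nil2 o one_add_one)
    moreover have "I (Suc j) ?s4"
      unfolding I_def using runs_bounded[OF R] s1 s' v by auto
    ultimately show ?thesis by blast
  qed
  have I0: "I 0 (s(v := 0))" using For.prems(10) v by (auto simp: I_def)
  have "\<exists>s'. runs x B (WhileLess v 0 ?body) (s(v := 0)) (concat (map (\<lambda>j. out x c (s(v := j))) [0..<?n]))
       (1 + (?n - 0) * (?T + 1)) s' \<and> I ?n s'"
    by (rule runs_count[where I = I])
      (use step I0 nbv v in \<open>auto simp: I_def\<close>)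
  then obtain s' where s': "runs x B (WhileLess v 0 ?body) (s(v := 0)) (out x (For v c) s)
       (1 + ?n * (?T + 1)) s'" "I ?n s'" by auto
  have R1: "runs x B (Do (Const v 0)) s [] 1 (s(v := 0))"
    by (rule runs_Do) (use For.prems(10) in auto)
  have "runs x B (comp_stm r (For v c)) s ([] @ out x (For v c) s) (1 + (1 + ?n * (?T + 1))) s'"
    unfolding comp_stm.simps by (rule runs_Seq[OF R1 s'(1)])
  moreover have "1 + (1 + ?n * (?T + 1)) \<le> stm_cost (For v c) * Suc ?n ^ stm_depth (For v c)"
  proof -
    have "1 \<le> Suc ?n ^ stm_depth c" by simp
    then have "Suc ?n \<le> Suc ?n * Suc ?n ^ stm_depth c" by (metis mult.right_neutral mult_le_mono2)
    moreover have "?n * (stm_cost c * Suc ?n ^ stm_depth c) \<le> Suc ?n * (stm_cost c * Suc ?n ^ stm_depth c)" by simp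
    moreover have "stm_cost (For v c) * Suc ?n ^ stm_depth (For v c) =
      Suc ?n * (stm_cost c * Suc ?n ^ stm_depth c) + 4 * (Suc ?n * Suc ?n ^ stm_depth c)"
      by (simp add: algebra_simps)
    moreover have "1 + (1 + ?n * (?T + 1)) = 2 + ?n * (stm_cost c * Suc ?n ^ stm_depth c) + 3 * ?n"
      by (simp add: algebra_simps)
    ultimately show ?thesis by linarith
  qed
  ultimately have R: "runs x B (comp_stm r (For v c)) s (out x (For v c) s)
      (stm_cost (For v c) * Suc ?n ^ stm_depth (For v c)) s'"
    unfolding append_Nil by (rule runs_weaken)
  show ?case by (rule exI, rule conjI, rule R) (use s'(2) in \<open>auto simp: I_def\<close>)
qed

section \<open>Bit lengths and the resources of a compiled program\<close>

lemma less_2_nbits: "a < 2 ^ nbits a"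
  using floor_log_exp2_gt[of a] by (simp add: nbits_def)

lemma nbits_pos: "1 \<le> nbits a"
  by (simp add: nbits_def)

lemma nbits_le: "a < 2 ^ m \<Longrightarrow> 1 \<le> m \<Longrightarrow> nbits a \<le> m"
proof -
  assume "a < 2 ^ m" "1 \<le> m"
  have "floor_log a < m"
  proof (cases "a = 0")
    case False
    then have "2 ^ floor_log a \<le> a" using floor_log_exp2_le by simp
    then show ?thesis using \<open>a < 2 ^ m\<close> by (metis le_less_trans nat_power_less_imp_less pos2)
  qed (use \<open>1 \<le> m\<close> in simp)
  then show ?thesis by (simp add: nbits_def)
qed

text \<open>From \<open>2 ^ p + 2 ^ q \<le> 2 ^ (p + q)\<close> for positive \<open>p\<close> and
  \<open>q\<close>. This is crude for large numbers, but constant factors are all that matters for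
  the space bound.\<close>

lemma nbits_add: "nbits (a + b) \<le> nbits a + nbits b"
proof (rule nbits_le)
  have "2 ^ nbits a \<ge> (2::nat)" "2 ^ nbits b \<ge> (2::nat)"
    using power_increasing[OF nbits_pos, of "2::nat"] by (simp_all del: One_nat_def)
  then obtain u v :: nat where "2 ^ nbits a = u + 2" "2 ^ nbits b = v + 2"
    by (metis add.commute le_Suc_ex)
  then show "a + b < 2 ^ (nbits a + nbits b)"
    using less_2_nbits[of a] less_2_nbits[of b] by (simp add: power_add algebra_simps)
qed (use nbits_pos[of a] in simp)

lemma nbits_power: "1 \<le> p \<Longrightarrow> nbits (a ^ p) \<le> p * nbits a"
proof (rule nbits_le)
  assume "1 \<le> p"
  then show "a ^ p < 2 ^ (p * nbits a)"
    using power_strict_mono[OF less_2_nbits[of a], of p] by (simp add: mult.commute flip: power_mult)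
  show "1 \<le> p * nbits a" using \<open>1 \<le> p\<close> nbits_pos[of a] by simp
qed

text \<open>The input is the parameter followed by the graph code, whose head is the number of
  vertices; hence position 1. The default 0 agrees with reading beyond the end and applies to the
  one-entry inputs of \<open>computable\<close>.\<close>

definition instance_size :: "nat list \<Rightarrow> nat" where
  "instance_size x = (if 1 < length x then x ! 1 else 0)"

lemma finite_regs: "finite (regs P)"
proof (induction P)
  case (Do i)
  then show ?case by (cases i) auto
qed auto

text \<open>\<open>K\<close> depends on \<open>c\<close> alone: the program has a fixed number of
  registers, and none exceeds a fixed power of \<open>Y\<close> plus a constant, whose bit length is
  a constant multiple of \<open>nbits Y\<close>.\<close>

lemma stm_computable:
  assumes "wf_stm 1 c"
  shows "\<exists>P K. \<forall>x Y. (\<forall>w\<in>set x. w \<le> Y) \<longrightarrow> (\<exists>t b.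
    computes P x (out x c ((\<lambda>_. 0)(0 := instance_size x))) t b \<and>
    t \<le> K * Suc (instance_size x) ^ stm_depth c \<and> b \<le> K * nbits Y)"
proof -
  define r where "r = Suc (Max (insert 0 (stm_vars c)))"
  have r: "v < r" if "v \<in> stm_vars c" for v
    using that finite_stm_vars[of c] by (simp add: r_def le_imp_less_Suc)
  have "0 < r" by (simp add: r_def)
  \<comment> \<open>Register 0 holds the address 1 and is then overwritten by the entry found
    there.\<close>
  define P where "P = Seq (Do (Const 0 1)) (Seq (Do (Read 0 0)) (comp_stm r c))"
  define X0 where "X0 = max 2 (stm_const c)"
  define g where "g = stm_growth c"
  define K1 where "K1 = stm_cost c + 2"
  define K2 where "K2 = card (regs P) * (g * (1 + nbits X0))"
  have main: "\<exists>t b. computes P x (out x c ((\<lambda>_. 0)(0 := instance_size x))) t b \<and>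
    t \<le> max K1 K2 * Suc (instance_size x) ^ stm_depth c \<and> b \<le> max K1 K2 * nbits Y"
    if Y: "\<forall>w\<in>set x. w \<le> Y" for x Y
  proof -
    let ?n = "instance_size x"
    define X where "X = Y + X0"
    define B where "B = X ^ g"
    let ?s0 = "(\<lambda>_. 0) :: store"
    let ?s1 = "?s0(0 := 1)"
    let ?s2 = "?s0(0 := ?n)"
    have X: "2 \<le> X" "stm_const c \<le> X" by (auto simp: X_def X0_def)
    have xX: "w \<le> X" if "w \<in> set x" for w using Y that by (simp add: X_def trans_le_add1)
    have g: "1 \<le> g" by (simp add: g_def stm_growth_pos Suc_le_eq)
    have XB: "X \<le> B" using self_le_power[of X g] X g by (simp add: B_def)
    have nX: "?n \<le> X" by (simp add: instance_size_def xX)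
    have R1: "runs x B (Do (Const 0 1)) ?s0 [] 1 ?s1"
      by (rule runs_Do) (use X XB in auto)
    have R2: "runs x B (Do (Read 0 0)) ?s1 [] 1 ?s2"
      by (rule runs_Do) (use X XB nX in \<open>auto simp: instance_size_def\<close>)
    have "\<exists>s'. runs x B (comp_stm r c) ?s2 (out x c ?s2) (stm_cost c * Suc (?s2 0) ^ stm_depth c) s' \<and>
      (\<forall>q<r. q \<notin> stm_vars c \<longrightarrow> s' q = ?s2 q)"
      by (rule runs_comp_stm[of 1 c r ?s2 X x B])
        (use assms r \<open>0 < r\<close> X xX nX order_trans[OF nX XB] in \<open>auto simp: B_def g_def Suc_le_eq\<close>)
    then obtain s' where R3: "runs x B (comp_stm r c) ?s2 (out x c ?s2) (stm_cost c * Suc (?s2 0) ^ stm_depth c) s'"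
      by blast
    from runs_Seq[OF R1 runs_Seq[OF R2 R3]]
    have "runs x B P ?s0 (out x c ?s2) (1 + (1 + stm_cost c * Suc ?n ^ stm_depth c)) s'"
      by (simp add: P_def)
    from runsE[OF this finite_regs[of P]] obtain t b where tb: "run x (regs P) P ?s0 (out x c ?s2) t b s'"
      "t \<le> 1 + (1 + stm_cost c * Suc ?n ^ stm_depth c)" "b \<le> card (regs P) * nbits B" .
    have "t \<le> K1 * Suc ?n ^ stm_depth c"
      using tb(2) one_le_power[of "Suc ?n" "stm_depth c"] unfolding K1_def distrib_right by linarith
    also have "\<dots> \<le> max K1 K2 * Suc ?n ^ stm_depth c" by simp
    finally have t: "t \<le> max K1 K2 * Suc ?n ^ stm_depth c" .
    have "nbits B \<le> g * nbits X" unfolding B_def using nbits_power[OF g] .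
    also have "nbits X \<le> nbits Y + nbits X0" unfolding X_def by (rule nbits_add)
    also have "\<dots> \<le> (1 + nbits X0) * nbits Y"
      using nbits_pos[of Y] by (simp add: algebra_simps)
    finally have "nbits B \<le> g * ((1 + nbits X0) * nbits Y)" by simp
    then have "b \<le> card (regs P) * (g * ((1 + nbits X0) * nbits Y))"
      using tb(3) mult_le_mono2 order_trans by blast
    also have "\<dots> = K2 * nbits Y" unfolding K2_def by (simp only: mult.assoc)
    also have "\<dots> \<le> max K1 K2 * nbits Y" by simp
    finally have b: "b \<le> max K1 K2 * nbits Y" .
    show ?thesis using tb(1) t b unfolding computes_def by blast
  qed
  show ?thesis by (rule exI[of _ P], rule exI[of _ "max K1 K2"]) (use main in blast)
qed

section \<open>Thinning a family of sets\<close>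

text \<open>\<open>set_encode\<close> is injective on finite sets, so "first" refers to a total
  order; being among the first \<open>m\<close> means having fewer than \<open>m\<close>
  predecessors. As a number it also provides the measure that makes repeated exchanges
  terminate.\<close>

primrec thin :: "nat \<Rightarrow> nat \<Rightarrow> nat set set \<Rightarrow> nat \<Rightarrow> nat set set" where
  "thin d t F 0 = F"
| "thin d t F (Suc l) = {f \<in> thin d t F l. \<forall>C\<subseteq>f. card C = d - Suc l \<longrightarrow>
     card {f' \<in> thin d t F l. C \<subseteq> f' \<and> set_encode f' < set_encode f} < t ^ Suc l}"

lemma thin_subset: "thin d t F l \<subseteq> F"
  by (induction l) auto

text \<open>Take the member of \<open>Y\<close> of largest rank: \<open>Y\<close> consists of this
  element and of elements below it, and there are fewer than \<open>m\<close> of the latter.\<close>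

lemma card_le_if_few_below:
  fixes r :: "'a \<Rightarrow> nat"
  assumes "finite A" "inj_on r A" "Y \<subseteq> A" "\<And>y. y \<in> Y \<Longrightarrow> card {a \<in> A. r a < r y} < m"
  shows "card Y \<le> m"
proof (cases "Y = {}")
  case False
  have "finite Y" using assms finite_subset by blast
  then have "Max (r ` Y) \<in> r ` Y" using False by (intro Max_in) auto
  then obtain y where y: "y \<in> Y" "r y = Max (r ` Y)" by auto
  have "Y \<subseteq> insert y {a \<in> A. r a < r y}"
  proof
    fix z assume z: "z \<in> Y"
    then have "r z \<le> r y" using y \<open>finite Y\<close> by simp
    moreover have "r z = r y \<Longrightarrow> z = y" using assms(2,3) z y(1) by (meson inj_onD subsetD)
    ultimately show "z \<in> insert y {a \<in> A. r a < r y}" using z assms(3) by fastforce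
  qed
  then have "card Y \<le> card (insert y {a \<in> A. r a < r y})"
    using assms(1) by (intro card_mono) auto
  also have "\<dots> \<le> Suc (card {a \<in> A. r a < r y})" by (rule card_insert_le_m1) auto
  also have "\<dots> \<le> m" using assms(4)[OF y(1)] by simp
  finally show ?thesis .
qed simp

text \<open>No induction is involved. At level 0 a core of size \<open>d\<close> is contained in
  itself only. At a later level, each surviving set has fewer than \<open>t ^ l\<close> predecessors
  among the sets of the level before that contain \<open>C\<close>, which bounds the
  survivors.\<close>

lemma card_thin_le:
  assumes F: "finite F" "\<And>f. f \<in> F \<Longrightarrow> finite f \<and> card f = d"
    and "l \<le> d" "finite C" "card C = d - l"
  shows "card {f \<in> thin d t F l. C \<subseteq> f} \<le> t ^ l"
proof (cases l)
  case 0
  have "{f \<in> thin d t F l. C \<subseteq> f} \<subseteq> {C}"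
  proof
    fix f assume f: "f \<in> {f \<in> thin d t F l. C \<subseteq> f}"
    then have "f \<in> F" using thin_subset[of d t F l] by auto
    then have "C = f" using f F(2) assms(5) 0 by (intro card_subset_eq) auto
    then show "f \<in> {C}" by simp
  qed
  then have "card {f \<in> thin d t F l. C \<subseteq> f} \<le> card {C}" by (intro card_mono) auto
  then show ?thesis using 0 by simp
next
  case (Suc l')
  let ?A = "{f \<in> thin d t F l'. C \<subseteq> f}"
  have sub: "?A \<subseteq> F" using thin_subset[of d t F l'] by auto
  show ?thesis
  proof (rule card_le_if_few_below[of ?A set_encode])
    show "finite ?A" using sub F(1) finite_subset by blast
    show "inj_on set_encode ?A"
      by (rule inj_on_subset[OF inj_on_set_encode]) (use sub F in auto)
    show "{f \<in> thin d t F l. C \<subseteq> f} \<subseteq> ?A" using Suc by auto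
    fix y assume "y \<in> {f \<in> thin d t F l. C \<subseteq> f}"
    then have "card {f' \<in> thin d t F l'. C \<subseteq> f' \<and> set_encode f' < set_encode y} < t ^ Suc l'"
      using Suc assms(5) by simp
    moreover have "{a \<in> ?A. set_encode a < set_encode y} =
      {f' \<in> thin d t F l'. C \<subseteq> f' \<and> set_encode f' < set_encode y}" by auto
    ultimately show "card {a \<in> ?A. set_encode a < set_encode y} < t ^ l" using Suc by simp
  qed
qed

text \<open>Of the sets containing the core \<open>C\<close> of a discarded set, fewer than \<open>t ^ Suc l\<close> meet the
  \<open>d * (k - 1)\<close> vertices of the rest of the packing, so some earlier set can take its place.\<close>

lemma packing_thin_Suc:
  assumes F: "finite F" "\<And>f. f \<in> F \<Longrightarrow> finite f \<and> card f = d"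
    and "l < d" and t: "t = d * (k - 1) + 1"
    and "P \<subseteq> thin d t F l" "finite P" "card P = k" "disjoint P"
  shows "\<exists>P' \<subseteq> thin d t F (Suc l). finite P' \<and> card P' = k \<and> disjoint P'"
  using assms(5-8)
\<comment> \<open>The set taken in exchange may itself be missing from the next level, so exchanges
  are repeated; each one lowers the sum of the codes.\<close>
proof (induction "\<Sum>f\<in>P. set_encode f" arbitrary: P rule: less_induct)
  case less
  note P = less.prems
  show ?case
  proof (cases "P \<subseteq> thin d t F (Suc l)")
    case True
    then show ?thesis using P by blast
  next
    case False
    then obtain f where f: "f \<in> P" "f \<notin> thin d t F (Suc l)" by blast
    then obtain C where C: "C \<subseteq> f" "card C = d - Suc l"
      and many: "t ^ Suc l \<le> card {f' \<in> thin d t F l. C \<subseteq> f' \<and> set_encode f' < set_encode f}"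
      using P(1) by (auto simp: not_less)
    have inF: "g \<in> F" if "g \<in> P" for g using P(1) thin_subset[of d t F l] that by auto
    have fin: "finite f" "finite C" using F inF f C finite_subset by blast+
    define Z where "Z = \<Union>(P - {f})"
    have Z: "finite Z" using F inF P(2) by (auto simp: Z_def)
    have "card Z \<le> (\<Sum>g\<in>P - {f}. card g)" unfolding Z_def
      using card_Union_le_sum_card by blast
    also have "\<dots> = (\<Sum>g\<in>P - {f}. d)" by (rule sum.cong) (use F inF in auto)
    also have "\<dots> = (k - 1) * d" using f P by simp
    finally have cZ: "card Z \<le> d * (k - 1)" by (simp add: mult.commute)
    have fZ: "f \<inter> Z = {}"
      using P(4) f(1) unfolding Z_def disjoint_def by blast
    let ?B = "{f' \<in> thin d t F l. C \<subseteq> f' \<and> set_encode f' < set_encode f}"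
    have finB: "finite {f' \<in> thin d t F l. D \<subseteq> f'}" for D
      using thin_subset[of d t F l] F(1) by (rule_tac finite_subset[of _ F]) auto
    have "\<exists>f'\<in>?B. f' \<inter> Z = {}"
    proof (rule ccontr)
      assume "\<not> ?thesis"
      \<comment> \<open>A set of \<open>?B\<close> that meets \<open>Z\<close> in \<open>z\<close>
        contains \<open>insert z C\<close>. As \<open>C\<close> is part of \<open>f\<close>, which
        is disjoint from \<open>Z\<close>, this core has size \<open>d - l\<close>, the size for
        which level \<open>l\<close> has the bound \<open>t ^ l\<close>.\<close>
      then have "?B \<subseteq> (\<Union>z\<in>Z. {f' \<in> thin d t F l. insert z C \<subseteq> f'})" by fastforce
      then have "card ?B \<le> card (\<Union>z\<in>Z. {f' \<in> thin d t F l. insert z C \<subseteq> f'})"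
        by (intro card_mono finite_UN_I Z finB)
      also have "\<dots> \<le> (\<Sum>z\<in>Z. card {f' \<in> thin d t F l. insert z C \<subseteq> f'})"
        using Z by (rule card_UN_le)
      also have "\<dots> \<le> (\<Sum>z\<in>Z. t ^ l)"
      proof (rule sum_mono)
        fix z assume "z \<in> Z"
        then have "z \<notin> C" using C fZ by auto
        then have "card (insert z C) = d - l" using C fin \<open>l < d\<close> by simp
        then show "card {f' \<in> thin d t F l. insert z C \<subseteq> f'} \<le> t ^ l"
          using F \<open>l < d\<close> fin by (intro card_thin_le) auto
      qed
      also have "\<dots> \<le> d * (k - 1) * t ^ l" using cZ by simp
      \<comment> \<open>The summand 1 in \<open>t\<close> makes this strict.\<close>
      also have "\<dots> < t ^ Suc l" by (simp add: t)
      finally show False using many by simp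
    qed
    then obtain f' where f': "f' \<in> thin d t F l" "set_encode f' < set_encode f" "f' \<inter> Z = {}"
      by auto
    have "f' \<in> F" using f'(1) thin_subset[of d t F l] by auto
    \<comment> \<open>Being disjoint from \<open>Z\<close> excludes membership in
      \<open>P - {f}\<close> only for nonempty sets. Without this the exchange could shrink the
      packing.\<close>
    then have "f' \<noteq> {}" using F(2) \<open>l < d\<close> by fastforce
    then have new: "f' \<notin> P - {f}" using f'(3) by (auto simp: Z_def)
    let ?P = "insert f' (P - {f})"
    have "(\<Sum>f\<in>?P. set_encode f) = set_encode f' + (\<Sum>f\<in>P - {f}. set_encode f)"
      using new P(2) by simp
    also have "\<dots> < set_encode f + (\<Sum>f\<in>P - {f}. set_encode f)" using f'(2) by simp
    also have "\<dots> = (\<Sum>f\<in>P. set_encode f)" using P(2) f(1) by (simp add: sum.remove)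
    finally have lt: "(\<Sum>f\<in>?P. set_encode f) < (\<Sum>f\<in>P. set_encode f)" .
    have "card ?P = Suc (card (P - {f}))" using new P(2) by (intro card_insert_disjoint) auto
    then have "card ?P = k" using card_Suc_Diff1[OF P(2) f(1)] P(3) by simp
    moreover have "disjoint ?P"
      using P(4) f'(3) unfolding Z_def disjoint_def by blast
    ultimately show ?thesis
      using less.hyps[OF lt] P(1,2) f'(1) by auto
  qed
qed

lemma packing_thin:
  assumes "finite F" "\<And>f. f \<in> F \<Longrightarrow> finite f \<and> card f = d" "t = d * (k - 1) + 1" "l \<le> d"
    and "P \<subseteq> F" "finite P" "card P = k" "disjoint P"
  shows "\<exists>P' \<subseteq> thin d t F l. finite P' \<and> card P' = k \<and> disjoint P'"
  using assms(4)
proof (induction l)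
  case 0
  then show ?case using assms by auto
next
  case (Suc l)
  then obtain P' where "P' \<subseteq> thin d t F l" "finite P'" "card P' = k" "disjoint P'" by auto
  then show ?case using packing_thin_Suc[OF assms(1,2) _ assms(3), of l P'] Suc.prems by simp
qed

section \<open>Packings as disjoint families of vertex sets\<close>

definition hosts :: "'a ugraph \<Rightarrow> 'b ugraph \<Rightarrow> 'b set set" where
  "hosts H G = {f. f \<subseteq> verts G \<and> (\<exists>g. bij_betw g (verts H) f \<and> (\<forall>e\<in>edges H. g ` e \<in> edges G))}"

text \<open>Occurrences need not be induced: on \<open>f\<close> one takes the image edges and
  nothing else, so further edges of \<open>G\<close> inside \<open>f\<close> do no harm.\<close>

lemma hosts_eq:
  assumes "simple_graph H" "simple_graph G"
  shows "f \<in> hosts H G \<longleftrightarrow> (\<exists>S. occurrence H S G \<and> verts S = f)"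
proof
  assume "f \<in> hosts H G"
  then obtain g where g: "f \<subseteq> verts G" "bij_betw g (verts H) f" "\<forall>e\<in>edges H. g ` e \<in> edges G"
    by (auto simp: hosts_def)
  let ?S = "(f, (\<lambda>e. g ` e) ` edges H)"
  have "g ` e \<subseteq> f" "card (g ` e) = 2" if "e \<in> edges H" for e
  proof -
    have e: "e \<subseteq> verts H" "card e = 2" using assms(1) that by (auto simp: simple_graph_def)
    then show "g ` e \<subseteq> f" using g(2) by (auto simp: bij_betw_def)
    show "card (g ` e) = 2"
      using e g(2) by (metis bij_betw_def card_image inj_on_subset)
  qed
  then have "simple_graph ?S"
    using assms(2) g(1) finite_subset by (auto simp: simple_graph_def)
  then have "occurrence H ?S G"
    using g by (auto simp: occurrence_def subgraph_def isomorphic_def)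
  then show "\<exists>S. occurrence H S G \<and> verts S = f" by (metis fst_conv)
next
  assume "\<exists>S. occurrence H S G \<and> verts S = f"
  then show "f \<in> hosts H G"
    by (auto simp: occurrence_def subgraph_def isomorphic_def hosts_def)
qed

lemma hosts_card:
  assumes "simple_graph G" "f \<in> hosts H G"
  shows "finite f \<and> card f = card (verts H)"
proof -
  obtain g where "f \<subseteq> verts G" "bij_betw g (verts H) f"
    using assms(2) unfolding hosts_def by blast
  then show ?thesis
    using assms(1) finite_subset bij_betw_same_card[of g] unfolding simple_graph_def by metis
qed

lemma finite_hosts: "simple_graph G \<Longrightarrow> finite (hosts H G)"
  unfolding hosts_def simple_graph_def by (rule finite_subset[of _ "Pow (verts G)"]) auto

text \<open>A packing is an indexed family, the right side a set of sets. They agree because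
  occurrences are nonempty: disjointness then separates the vertex sets of different indices. For an
  empty pattern the same empty set could be used \<open>k\<close> times.\<close>

lemma H_packing_iff:
  fixes H :: "'a ugraph" and G :: "'b ugraph"
  assumes "simple_graph H" "simple_graph G" "0 < card (verts H)"
  shows "(G, k) \<in> H_packing H \<longleftrightarrow> (\<exists>P \<subseteq> hosts H G. finite P \<and> card P = k \<and> disjoint P)"
proof
  assume "(G, k) \<in> H_packing H"
  then have "\<exists>S :: nat \<Rightarrow> 'b ugraph. (\<forall>i<k. occurrence H (S i) G) \<and>
     (\<forall>i<k. \<forall>j<k. i \<noteq> j \<longrightarrow> verts (S i) \<inter> verts (S j) = {})"
    unfolding H_packing_def mem_Collect_eq prod.case .
  then obtain S :: "nat \<Rightarrow> 'b ugraph" where "(\<forall>i<k. occurrence H (S i) G) \<and>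
     (\<forall>i<k. \<forall>j<k. i \<noteq> j \<longrightarrow> verts (S i) \<inter> verts (S j) = {})" by (rule exE)
  then have S: "\<forall>i<k. occurrence H (S i) G"
    "\<forall>i<k. \<forall>j<k. i \<noteq> j \<longrightarrow> verts (S i) \<inter> verts (S j) = {}" by (rule conjunct1, rule conjunct2)
  have h: "verts (S i) \<in> hosts H G" if "i < k" for i
    using S(1) that hosts_eq[OF assms(1,2)] by blast
  have ne: "verts (S i) \<noteq> {}" if "i < k" for i
    using hosts_card[OF assms(2) h[OF that]] assms(3) by auto
  have "inj_on (\<lambda>i. verts (S i)) {..<k}"
    by (rule inj_onI) (metis S(2) ne lessThan_iff inf.idem)
  then have "card ((\<lambda>i. verts (S i)) ` {..<k}) = k" by (simp add: card_image)
  moreover have "disjoint ((\<lambda>i. verts (S i)) ` {..<k})"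
    using S(2) unfolding disjoint_def by fastforce
  ultimately show "\<exists>P \<subseteq> hosts H G. finite P \<and> card P = k \<and> disjoint P"
    using h by (intro exI[of _ "(\<lambda>i. verts (S i)) ` {..<k}"]) auto
next
  assume "\<exists>P \<subseteq> hosts H G. finite P \<and> card P = k \<and> disjoint P"
  then obtain P where P: "P \<subseteq> hosts H G" "finite P" "card P = k" "disjoint P" by blast
  then obtain b where b: "bij_betw b {..<k} P"
    using ex_bij_betw_nat_finite[of P] by (auto simp: atLeast0LessThan)
  have "\<forall>f\<in>P. \<exists>S. occurrence H S G \<and> verts S = f"
    using P(1) hosts_eq[OF assms(1,2)] by blast
  then obtain S where S: "\<forall>f\<in>P. occurrence H (S f) G \<and> verts (S f) = f" by metis
  have bP: "b i \<in> P" if "i < k" for i using b that by (auto simp: bij_betw_def)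
  have "b i \<inter> b j = {}" if "i < k" "j < k" "i \<noteq> j" for i j
    using P(4) bP that b unfolding disjoint_def bij_betw_def by (metis inj_on_eq_iff lessThan_iff)
  then have "(\<forall>i<k. occurrence H (S (b i)) G) \<and>
     (\<forall>i<k. \<forall>j<k. i \<noteq> j \<longrightarrow> verts (S (b i)) \<inter> verts (S (b j)) = {})"
    using S bP by simp
  then show "(G, k) \<in> H_packing H"
    unfolding H_packing_def mem_Collect_eq prod.case by (rule exI[where x = "\<lambda>i. S (b i)"])
qed

text \<open>Only edges inside \<open>f\<close> have to be preserved. The kernel guarantees no more,
  since it keeps just the edges lying in retained sets.\<close>

lemma hosts_image:
  assumes "simple_graph H" "f \<in> hosts H G" "inj_on h f" "h ` f \<subseteq> verts G'"
    and "\<And>e. e \<in> edges G \<Longrightarrow> e \<subseteq> f \<Longrightarrow> h ` e \<in> edges G'"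
  shows "h ` f \<in> hosts H G'"
proof -
  obtain g where g: "bij_betw g (verts H) f" "\<forall>e\<in>edges H. g ` e \<in> edges G"
    using assms(2) by (auto simp: hosts_def)
  have "bij_betw (h \<circ> g) (verts H) (h ` f)"
    using g(1) assms(3) by (metis bij_betw_trans inj_on_imp_bij_betw)
  moreover have "(h \<circ> g) ` e \<in> edges G'" if "e \<in> edges H" for e
  proof -
    have "g ` e \<subseteq> f" using g(1) assms(1) that by (auto simp: bij_betw_def simple_graph_def)
    then have "h ` (g ` e) \<in> edges G'" using g(2) that assms(5) by blast
    then show ?thesis by (simp add: image_comp)
  qed
  ultimately show ?thesis using assms(4) by (auto simp: hosts_def)
qed

lemma packing_image:
  assumes "finite P" "card P = k" "disjoint P" "inj_on h (\<Union>P)"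
  shows "finite ((`) h ` P) \<and> card ((`) h ` P) = k \<and> disjoint ((`) h ` P)"
proof -
  have "inj_on ((`) h) P" by (rule inj_on_image[OF assms(4)])
  moreover have "disjoint ((`) h ` P)"
  proof (rule disjointI)
    fix a b assume ab: "a \<in> (`) h ` P" "b \<in> (`) h ` P" "a \<noteq> b"
    then obtain f g where fg: "f \<in> P" "g \<in> P" "a = h ` f" "b = h ` g" by auto
    then have "f \<inter> g = {}" using assms(3) ab(3) by (auto simp: disjoint_def)
    then show "a \<inter> b = {}" using inj_on_image_Int[OF assms(4), of f g] fg by auto
  qed
  ultimately show ?thesis using assms by (simp add: card_image)
qed

section \<open>The kernel graph\<close>

definition spanned :: "nat ugraph \<Rightarrow> nat set set \<Rightarrow> nat \<Rightarrow> nat \<Rightarrow> bool" where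
  "spanned G F u v \<longleftrightarrow> {u, v} \<in> edges G \<and> (\<exists>f\<in>F. u \<in> f \<and> v \<in> f)"

text \<open>Instances must have an initial segment of the numbers as vertex set, so a retained
  vertex is renamed to its position in \<open>L\<close>.\<close>

definition relabelled :: "nat ugraph \<Rightarrow> nat set set \<Rightarrow> nat list \<Rightarrow> nat ugraph" where
  "relabelled G F L = ({..<length L},
     {{i, j} | i j. i < length L \<and> j < length L \<and> spanned G F (L ! i) (L ! j)})"

context
  fixes H :: "'a ugraph" and G :: "nat ugraph" and F :: "nat set set" and L :: "nat list"
  assumes H: "simple_graph H" and G: "simple_graph G" and F: "F \<subseteq> hosts H G"
    and L: "distinct L" "set L = \<Union>F"
begin

lemma relabelled_inj: "inj_on ((!) L) {..<length L}"
  using L(1) by (simp add: inj_on_nth)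

lemma relabelled_edge:
  "e \<in> edges (relabelled G F L) \<longleftrightarrow> e \<subseteq> {..<length L} \<and> (!) L ` e \<in> edges G \<and> (\<exists>f\<in>F. (!) L ` e \<subseteq> f)"
  (is "?l \<longleftrightarrow> ?r")
proof
  assume ?l
  then show ?r by (auto simp: relabelled_def spanned_def)
next
  assume r: ?r
  then have "card ((!) L ` e) = 2" using G by (auto simp: simple_graph_def)
  moreover have "inj_on ((!) L) e"
    by (rule inj_on_subset[OF relabelled_inj]) (use r in auto)
  ultimately have "card e = 2" by (simp add: card_image)
  then obtain i j where "e = {i, j}" by (auto simp: card_2_iff)
  then show ?l using r by (auto simp: relabelled_def spanned_def)
qed

lemma relabelled_input: "relabelled G F L \<in> input_graphs"
proof -
  have "card e = 2" if e: "e \<in> edges (relabelled G F L)" for e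
  proof -
    have "card ((!) L ` e) = 2" "e \<subseteq> {..<length L}"
      using G e by (auto simp: simple_graph_def relabelled_edge)
    then show ?thesis using relabelled_inj by (metis card_image inj_on_subset)
  qed
  moreover have "verts (relabelled G F L) = {..<length L}" by (simp add: relabelled_def)
  ultimately show ?thesis
    unfolding input_graphs_def simple_graph_def by (auto simp: relabelled_edge)
qed

text \<open>A host in the kernel need not come from a member of \<open>F\<close>, but
  \<open>(!) L\<close> embeds the kernel into \<open>G\<close> and turns it into a host there.
  Conversely, \<open>thin\<close> first moves a packing of \<open>G\<close> into \<open>F\<close>;
  inside members of \<open>F\<close> no edge has been lost, so the inverse renaming applies.\<close>

lemma relabelled_packing:
  assumes "0 < card (verts H)"
    and thin: "\<And>P. P \<subseteq> hosts H G \<Longrightarrow> finite P \<Longrightarrow> card P = k \<Longrightarrow> disjoint P \<Longrightarrow>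
       \<exists>P' \<subseteq> F. finite P' \<and> card P' = k \<and> disjoint P'"
  shows "(relabelled G F L, k) \<in> H_packing H \<longleftrightarrow> (G, k) \<in> H_packing H"
proof -
  let ?G = "relabelled G F L"
  have sG: "simple_graph ?G" using relabelled_input by (simp add: input_graphs_def)
  have vG: "verts ?G = {..<length L}" by (simp add: relabelled_def)
  have "\<Union>F \<subseteq> verts G" using F by (auto simp: hosts_def)
  show ?thesis unfolding H_packing_iff[OF H sG assms(1)] H_packing_iff[OF H G assms(1)]
  proof
    assume "\<exists>P \<subseteq> hosts H ?G. finite P \<and> card P = k \<and> disjoint P"
    then obtain P where P: "P \<subseteq> hosts H ?G" "finite P" "card P = k" "disjoint P" by blast
    have sub: "\<Union>P \<subseteq> {..<length L}" using P(1) vG by (auto simp: hosts_def)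
    have "(!) L ` f \<in> hosts H G" if "f \<in> P" for f
    proof (rule hosts_image[OF H])
      show "f \<in> hosts H ?G" using that P by blast
      show "inj_on ((!) L) f" by (rule inj_on_subset[OF relabelled_inj]) (use sub that in blast)
      show "(!) L ` f \<subseteq> verts G"
      proof
        fix v assume "v \<in> (!) L ` f"
        then obtain i where i: "i \<in> f" "v = L ! i" by blast
        then have "i < length L" using that sub by blast
        then have "v \<in> \<Union>F" using nth_mem[of i L] L(2) i by simp
        then show "v \<in> verts G" using \<open>\<Union>F \<subseteq> verts G\<close> by blast
      qed
    qed (simp add: relabelled_edge)
    then show "\<exists>P \<subseteq> hosts H G. finite P \<and> card P = k \<and> disjoint P"
      using packing_image[OF P(2-4) inj_on_subset[OF relabelled_inj sub]]
      by (intro exI[of _ "(`) ((!) L) ` P"]) auto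
  next
    assume "\<exists>P \<subseteq> hosts H G. finite P \<and> card P = k \<and> disjoint P"
    then obtain P0 where "P0 \<subseteq> hosts H G" "finite P0" "card P0 = k" "disjoint P0" by blast
    from thin[OF this] obtain P where P: "P \<subseteq> F" "finite P" "card P = k" "disjoint P" by blast
    define h where "h = inv_into {..<length L} ((!) L)"
    have img: "(!) L ` {..<length L} = \<Union>F" using L(2) by (auto simp: set_conv_nth)
    have inj: "inj_on h (\<Union>F)" unfolding h_def img[symmetric] by (rule inj_on_inv_into) simp
    have h_back: "(!) L ` (h ` e) = e" "h ` e \<subseteq> {..<length L}" if "e \<subseteq> \<Union>F" for e
    proof -
      show "(!) L ` (h ` e) = e" using that img unfolding h_def
        by (simp add: image_inv_into_cancel)
      show "h ` e \<subseteq> {..<length L}" unfolding h_def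
        using that img by (auto intro!: inv_into_into[of _ "(!) L" "{..<length L}", simplified])
    qed
    have "h ` f \<in> hosts H ?G" if "f \<in> P" for f
    proof (rule hosts_image[OF H])
      show "f \<in> hosts H G" using that P F by blast
      have sub: "f \<subseteq> \<Union>F" using that P by blast
      show "inj_on h f" using inj sub by (rule inj_on_subset)
      show "h ` f \<subseteq> verts ?G" using h_back(2)[OF sub] vG by simp
      fix e assume e: "e \<in> edges G" "e \<subseteq> f"
      then have "e \<subseteq> \<Union>F" using sub by blast
      then show "h ` e \<in> edges ?G" unfolding relabelled_edge
        using h_back e that P(1) by auto
    qed
    moreover have "inj_on h (\<Union>P)" using inj by (rule inj_on_subset) (use P in auto)
    ultimately show "\<exists>P \<subseteq> hosts H ?G. finite P \<and> card P = k \<and> disjoint P"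
      using packing_image[OF P(2-4)] by (intro exI[of _ "(`) h ` P"]) auto
  qed
qed

lemma finite_F: "finite F"
  using finite_hosts[OF G] F finite_subset by blast

text \<open>Renamed back, each edge is a pair inside some member of \<open>F\<close>, and a member
  has \<open>card (verts H) choose 2\<close> pairs.\<close>

lemma relabelled_card_edges:
  "card (edges (relabelled G F L)) \<le> card (verts H) * (card (verts H) - 1) div 2 * card F"
proof -
  let ?pairs = "\<lambda>f. {e. e \<subseteq> f \<and> card e = 2}"
  have f: "finite f \<and> card f = card (verts H)" if "f \<in> F" for f
    using hosts_card[OF G] that F by blast
  have "card (edges (relabelled G F L)) = card ((`) ((!) L) ` edges (relabelled G F L))"
  proof (rule card_image[symmetric], rule inj_on_image, rule inj_on_subset[OF relabelled_inj])
    show "\<Union> (edges (relabelled G F L)) \<subseteq> {..<length L}" by (auto simp: relabelled_edge)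
  qed
  also have "\<dots> \<le> card (\<Union>f\<in>F. ?pairs f)"
  proof (rule card_mono)
    show "finite (\<Union>f\<in>F. ?pairs f)" using finite_F f by auto
    show "(`) ((!) L) ` edges (relabelled G F L) \<subseteq> (\<Union>f\<in>F. ?pairs f)"
      using G by (fastforce simp: relabelled_edge simple_graph_def)
  qed
  also have "\<dots> \<le> (\<Sum>f\<in>F. card (?pairs f))" by (rule card_UN_le[OF finite_F])
  also have "\<dots> = (\<Sum>f\<in>F. card (verts H) choose 2)"
    by (rule sum.cong) (use f in \<open>auto simp: n_subsets\<close>)
  also have "\<dots> = card (verts H) * (card (verts H) - 1) div 2 * card F"
    by (simp add: choose_two mult.commute)
  finally show ?thesis .
qed

lemma relabelled_length: "length L \<le> card (verts H) * card F"
proof -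
  have "length L = card (\<Union>F)" using L distinct_card by metis
  also have "\<dots> \<le> (\<Sum>f\<in>F. card f)" by (rule card_Union_le_sum_card)
  also have "\<dots> = (\<Sum>f\<in>F. card (verts H))"
    by (rule sum.cong) (use hosts_card[OF G, of _ H] F in auto)
  finally show ?thesis by (simp add: mult.commute)
qed

text \<open>New names do not occur in an adjacency matrix, only their order matters. So a program
  can print the code while running through the old vertices, without computing the renaming.\<close>

lemma relabelled_code: "graph_code (relabelled G F L) =
  length L # map (\<lambda>(u, v). of_bool (spanned G F u v)) (List.product L L)"
proof -
  have vG: "verts (relabelled G F L) = {..<length L}" by (simp add: relabelled_def)
  have e: "{i, j} \<in> edges (relabelled G F L) \<longleftrightarrow> spanned G F (L ! i) (L ! j)"
    if "i < length L" "j < length L" for i j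
    using that by (auto simp: relabelled_edge spanned_def)
  have "List.product L L = map (\<lambda>(i, j). (L ! i, L ! j)) (List.product [0..<length L] [0..<length L])"
    (is "_ = ?r")
  proof -
    have "List.product L L = List.product (map ((!) L) [0..<length L]) (map ((!) L) [0..<length L])"
      by (simp add: map_nth)
    also have "\<dots> = ?r"
      by (simp add: product_concat_map map_concat comp_def)
    finally show ?thesis .
  qed
  then show ?thesis
    by (auto simp: graph_code_def Let_def vG e)
qed

end

section \<open>The kernel as a program\<close>

text \<open>The powers of two below \<open>2 ^ v\<close> add up to less than \<open>2 ^ v\<close>,
  so \<open>v\<close> alone outweighs the part of \<open>A\<close> outside \<open>B\<close>.\<close>

lemma set_encode_less:
  assumes "finite A" "finite B" "v \<in> B" "v \<notin> A" "\<forall>u\<in>A. u \<in> B \<or> u < v"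
  shows "set_encode A < set_encode B"
proof -
  have "set_encode (A - B) \<le> set_encode {..<v}"
    unfolding set_encode_def using assms by (intro sum_mono2) auto
  also have "\<dots> < 2 ^ v"
    by (simp add: set_encode_def lessThan_atLeast0 sum_power2)
  also have "\<dots> = set_encode {v}" by simp
  also have "\<dots> \<le> set_encode (B - A)"
    unfolding set_encode_def using assms by (intro sum_mono2) auto
  finally have "set_encode (A \<inter> B) + set_encode (A - B) < set_encode (A \<inter> B) + set_encode (B - A)"
    by simp
  moreover have "set_encode A = set_encode (A \<inter> B) + set_encode (A - B)"
    using sum.Int_Diff[of A "(^) 2" B] assms(1) by (simp add: set_encode_def)
  moreover have "set_encode B = set_encode (A \<inter> B) + set_encode (B - A)"
    using sum.Int_Diff[of B "(^) 2" A] assms(2) by (simp add: set_encode_def Int_commute)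
  ultimately show ?thesis by simp
qed

text \<open>The largest element of the symmetric difference decides. The right side needs only
  comparisons of vertices, whereas a code can have linearly many bits, too many for logarithmic
  space.\<close>

lemma set_encode_less_iff:
  assumes "finite A" "finite B"
  shows "set_encode A < set_encode B \<longleftrightarrow> (\<exists>v\<in>B. v \<notin> A \<and> (\<forall>u\<in>A. u \<in> B \<or> u < v))"
proof
  assume less: "set_encode A < set_encode B"
  let ?D = "(A - B) \<union> (B - A)"
  have "?D \<noteq> {}" using less by auto
  moreover have "finite ?D" using assms by simp
  ultimately have m: "Max ?D \<in> ?D" "\<forall>u\<in>?D. u \<le> Max ?D" by (auto simp del: Un_iff)
  show "\<exists>v\<in>B. v \<notin> A \<and> (\<forall>u\<in>A. u \<in> B \<or> u < v)"
  proof (cases "Max ?D \<in> B")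
    case True
    then show ?thesis using m by (intro bexI[of _ "Max ?D"]) (auto simp: less_le)
  next
    case False
    then have "set_encode B < set_encode A"
      using m assms by (intro set_encode_less[of _ _ "Max ?D"]) (auto simp: less_le)
    then show ?thesis using less by simp
  qed
qed (use set_encode_less assms in blast)

text \<open>Loops run over tuples; increasing order selects one tuple for each set. Disjointness
  from \<open>C\<close> comes for free, as the union has to reach size \<open>d\<close>.\<close>

lemma card_sorted_lists:
  fixes C :: "nat set"
  assumes "finite C" "card C = d - q" "q \<le> d" "T \<subseteq> {f. f \<subseteq> {..<n} \<and> card f = d}"
  shows "card {ws. length ws = q \<and> set ws \<subseteq> {..<n} \<and> sorted_wrt (<) ws \<and> C \<union> set ws \<in> T} =
    card {f \<in> T. C \<subseteq> f}"
proof (rule bij_betw_same_card[of "\<lambda>ws. C \<union> set ws"])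
  let ?W = "{ws. length ws = q \<and> set ws \<subseteq> {..<n} \<and> sorted_wrt (<) ws \<and> C \<union> set ws \<in> T}"
  have rest: "set ws = (C \<union> set ws) - C" if "ws \<in> ?W" for ws
  proof -
    have "card (C \<union> set ws) = d" using that assms(4) by auto
    moreover have "card (set ws) = q" using that by (simp add: strict_sorted_iff distinct_card)
    ultimately have "card (C \<inter> set ws) = 0"
      using card_Un_Int[OF assms(1), of "set ws"] assms(2,3) by simp
    then show ?thesis using assms(1) by auto
  qed
  show "bij_betw (\<lambda>ws. C \<union> set ws) ?W {f \<in> T. C \<subseteq> f}"
    unfolding bij_betw_def
  proof
    show "inj_on (\<lambda>ws. C \<union> set ws) ?W"
    proof (rule inj_onI)
      fix ws ws' assume w: "ws \<in> ?W" "ws' \<in> ?W" "C \<union> set ws = C \<union> set ws'"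
      then have "set ws = set ws'" using rest[OF w(1)] rest[OF w(2)] by simp
      then show "ws = ws'" using w by (auto intro: strict_sorted_equal)
    qed
    show "(\<lambda>ws. C \<union> set ws) ` ?W = {f \<in> T. C \<subseteq> f}"
    proof
      show "{f \<in> T. C \<subseteq> f} \<subseteq> (\<lambda>ws. C \<union> set ws) ` ?W"
      proof
        fix f assume f: "f \<in> {f \<in> T. C \<subseteq> f}"
        then have "f \<subseteq> {..<n}" "card f = d" using assms(4) by auto
        then have fin: "finite f" using finite_subset by blast
        have "card (f - C) = q" using f \<open>card f = d\<close> assms(1-3) by (simp add: card_Diff_subset)
        moreover have "f = C \<union> (f - C)" using f by auto
        ultimately have "sorted_list_of_set (f - C) \<in> ?W"
          using f fin \<open>f \<subseteq> {..<n}\<close> by (auto simp: Un_absorb1)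
        moreover have "f = C \<union> set (sorted_list_of_set (f - C))" using f fin by auto
        ultimately show "f \<in> (\<lambda>ws. C \<union> set ws) ` ?W" by blast
      qed
    qed auto
  qed
qed

section \<open>Formulas as expressions\<close>

abbreviation holds :: "nat list \<Rightarrow> exp \<Rightarrow> store \<Rightarrow> bool" where
  "holds x a s \<equiv> 0 < eval x a s"

abbreviation less_exp :: "nat \<Rightarrow> nat \<Rightarrow> exp" where
  "less_exp u v \<equiv> Op LessOp (V u) (V v)"

text \<open>As truth is positivity, product and sum are conjunction and disjunction without any
  normalisation.\<close>

definition conj_exp :: "exp list \<Rightarrow> exp" where
  "conj_exp es = foldr (Op TimesOp) es (N 1)"

definition disj_exp :: "exp list \<Rightarrow> exp" where
  "disj_exp es = foldr (Op PlusOp) es (N 0)"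

text \<open>Restores values 0 and 1, so that a surrounding \<open>Sum\<close> counts instead of
  adding arbitrary positive numbers.\<close>

definition pos_exp :: "exp \<Rightarrow> exp" where
  "pos_exp a = Op LessOp (N 0) a"

definition neq_exp :: "nat \<Rightarrow> nat \<Rightarrow> exp" where
  "neq_exp u v = disj_exp [less_exp u v, less_exp v u]"

text \<open>Truncated subtraction from 1 is negation.\<close>

definition eq_exp :: "nat \<Rightarrow> nat \<Rightarrow> exp" where
  "eq_exp u v = Op MinusOp (N 1) (neq_exp u v)"

text \<open>The right side of \<open>set_encode_less_iff\<close>, with its quantifiers unrolled. The
  arguments are lists of register numbers; the sets compared are those of the register
  contents.\<close>

definition before_exp :: "nat list \<Rightarrow> nat list \<Rightarrow> exp" where
  "before_exp us vs = disj_exp (map (\<lambda>v. conj_exp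
     (map (neq_exp v) us @ map (\<lambda>u. disj_exp (less_exp u v # map (eq_exp u) vs)) us)) vs)"

text \<open>The filter compares register numbers. It is used on consecutive registers, where their
  order is the order of the tuple.\<close>

definition sorted_exp :: "nat list \<Rightarrow> exp" where
  "sorted_exp us = conj_exp (map (\<lambda>(u, v). less_exp u v) (filter (\<lambda>(u, v). u < v) (List.product us us)))"

text \<open>The offset 2 skips the parameter and the number of vertices, which are followed by the
  matrix row by row; \<open>V 0\<close> is the row length.\<close>

definition adj_exp :: "nat \<Rightarrow> nat \<Rightarrow> exp" where
  "adj_exp u v = Rd (Op PlusOp (N 2) (Op PlusOp (Op TimesOp (V u) (V 0)) (V v)))"

primrec pow_exp :: "exp \<Rightarrow> nat \<Rightarrow> exp" where
  "pow_exp a 0 = N 1"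
| "pow_exp a (Suc l) = Op TimesOp a (pow_exp a l)"

definition sum_exp :: "nat \<Rightarrow> nat \<Rightarrow> exp \<Rightarrow> exp" where
  "sum_exp m q a = foldr Sum [m..<m + q] a"

text \<open>\<open>Rd (N 0)\<close> is the parameter \<open>k\<close>, so the value is
  \<open>t\<close>, with the same truncated \<open>k - 1\<close>.\<close>

definition threshold_exp :: "nat \<Rightarrow> exp" where
  "threshold_exp d = Op PlusOp (Op TimesOp (N d) (Op MinusOp (Rd (N 0)) (N 1))) (N 1)"

lemma holds_conj [simp]: "holds x (conj_exp es) s \<longleftrightarrow> (\<forall>a\<in>set es. holds x a s)"
  unfolding conj_exp_def by (induction es) auto

lemma holds_disj [simp]: "holds x (disj_exp es) s \<longleftrightarrow> (\<exists>a\<in>set es. holds x a s)"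
  unfolding disj_exp_def by (induction es) auto

lemma eval_pos [simp]: "eval x (pos_exp a) s = of_bool (holds x a s)"
  by (simp add: pos_exp_def)

lemma holds_neq [simp]: "holds x (neq_exp u v) s \<longleftrightarrow> s u \<noteq> s v"
  by (auto simp: neq_exp_def)

lemma holds_eq [simp]: "holds x (eq_exp u v) s \<longleftrightarrow> s u = s v"
  using holds_neq[of x u v s] by (simp add: eq_exp_def del: holds_neq) (metis neq0_conv)

lemma holds_before [simp]:
  "holds x (before_exp us vs) s \<longleftrightarrow> set_encode (s ` set us) < set_encode (s ` set vs)"
proof -
  have "holds x (before_exp us vs) s \<longleftrightarrow> (\<exists>v\<in>set vs. (\<forall>u\<in>set us. s v \<noteq> s u) \<and>
     (\<forall>u\<in>set us. s u < s v \<or> (\<exists>w\<in>set vs. s u = s w)))"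
    by (simp add: before_exp_def ball_Un)
  also have "\<dots> \<longleftrightarrow> (\<exists>v\<in>s ` set vs. v \<notin> s ` set us \<and> (\<forall>u\<in>s ` set us. u \<in> s ` set vs \<or> u < v))"
    by (simp add: image_iff) (metis (no_types))
  finally show ?thesis by (simp add: set_encode_less_iff)
qed

lemma holds_sorted:
  "holds x (sorted_exp us) s \<longleftrightarrow> (\<forall>u\<in>set us. \<forall>v\<in>set us. u < v \<longrightarrow> s u < s v)"
  by (auto simp: sorted_exp_def)

lemma eval_pow [simp]: "eval x (pow_exp a l) s = eval x a s ^ l"
  by (induction l) auto

lemma eval_threshold: "eval (k # y) (threshold_exp d) s = d * (k - 1) + 1"
  by (simp add: threshold_exp_def)

definition assign :: "nat \<Rightarrow> nat list \<Rightarrow> store \<Rightarrow> store" where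
  "assign m ws s = (\<lambda>v. if m \<le> v \<and> v < m + length ws then ws ! (v - m) else s v)"

lemma finite_lists_length: "finite {ws. length ws = q \<and> set ws \<subseteq> {..<n::nat}}"
  using finite_lists_length_eq[of "{..<n}" q] by (simp add: conj_commute)

text \<open>Nested loops on consecutive registers enumerate all tuples, the outermost giving the
  first entry. \<open>0 < m\<close> keeps the loop bound in register 0 from being
  overwritten.\<close>

lemma eval_sum_exp:
  assumes "0 < m"
  shows "eval x (sum_exp m q a) s =
    (\<Sum>ws | length ws = q \<and> set ws \<subseteq> {..<s 0}. eval x a (assign m ws s))"
  using assms
proof (induction q arbitrary: m s)
  case 0
  have "{ws. ws = [] \<and> set ws \<subseteq> {..<s 0}} = {[]}" by auto
  moreover have "assign m [] s = s" by (auto simp: assign_def fun_eq_iff)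
  ultimately show ?case by (simp add: sum_exp_def)
next
  case (Suc q)
  let ?W = "\<lambda>q. {ws. length ws = q \<and> set ws \<subseteq> {..<s 0}}"
  have "sum_exp m (Suc q) a = Sum m (sum_exp (Suc m) q a)"
    by (simp add: sum_exp_def upt_conv_Cons del: upt_Suc)
  then have "eval x (sum_exp m (Suc q) a) s =
    (\<Sum>j<s 0. \<Sum>ws\<in>?W q. eval x a (assign (Suc m) ws (s(m := j))))"
    using Suc.IH[of "Suc m"] Suc.prems by simp
  also have "\<dots> = (\<Sum>(j, ws)\<in>{..<s 0} \<times> ?W q. eval x a (assign m (j # ws) s))"
  proof (subst sum.cartesian_product, rule sum.cong[OF refl])
    have "assign (Suc m) ws (s(m := j)) = assign m (j # ws) s" for ws j
      by (auto simp: assign_def fun_eq_iff nth_Cons' Suc_diff_Suc)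
    then show "(case p of (j, ws) \<Rightarrow> eval x a (assign (Suc m) ws (s(m := j)))) =
      (case p of (j, ws) \<Rightarrow> eval x a (assign m (j # ws) s))" for p by simp
  qed
  also have "\<dots> = (\<Sum>ws\<in>?W (Suc q). eval x a (assign m ws s))"
    by (rule sum.reindex_bij_witness[where i = "\<lambda>ws. (hd ws, tl ws)" and j = "\<lambda>(j, ws). j # ws"])
      (auto simp: length_Suc_conv)
  finally show ?case .
qed

lemma wf_conj [simp]: "wf_exp m (conj_exp es) \<longleftrightarrow> (\<forall>a\<in>set es. wf_exp m a)"
  unfolding conj_exp_def by (induction es) auto

lemma wf_disj [simp]: "wf_exp m (disj_exp es) \<longleftrightarrow> (\<forall>a\<in>set es. wf_exp m a)"
  unfolding disj_exp_def by (induction es) auto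

lemma wf_before: "(\<And>v. v \<in> set us \<union> set vs \<Longrightarrow> v < m) \<Longrightarrow> wf_exp m (before_exp us vs)"
  by (auto simp: before_exp_def neq_exp_def eq_exp_def)

lemma wf_pow: "wf_exp m a \<Longrightarrow> wf_exp m (pow_exp a l)"
  by (induction l) auto

lemma wf_sum: "wf_exp (m + q) a \<Longrightarrow> wf_exp m (sum_exp m q a)"
proof (induction q arbitrary: m)
  case (Suc q)
  have "sum_exp m (Suc q) a = Sum m (sum_exp (Suc m) q a)"
    by (simp add: sum_exp_def upt_conv_Cons del: upt_Suc)
  then show ?case using Suc by simp
qed (simp add: sum_exp_def)

lemma depth_conj: "(\<And>a. a \<in> set es \<Longrightarrow> depth a \<le> D) \<Longrightarrow> depth (conj_exp es) \<le> D"
  unfolding conj_exp_def by (induction es) auto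

lemma depth_disj: "(\<And>a. a \<in> set es \<Longrightarrow> depth a \<le> D) \<Longrightarrow> depth (disj_exp es) \<le> D"
  unfolding disj_exp_def by (induction es) auto

lemma depth_neq [simp]: "depth (neq_exp u v) = 0"
  by (simp add: neq_exp_def disj_exp_def)

lemma depth_eq [simp]: "depth (eq_exp u v) = 0"
  by (simp add: eq_exp_def)

lemma depth_adj [simp]: "depth (adj_exp u v) = 0"
  by (simp add: adj_exp_def)

lemma depth_before: "depth (before_exp us vs) \<le> D"
  unfolding before_exp_def by (intro depth_disj) (auto intro!: depth_conj depth_disj)

lemma depth_sorted: "depth (sorted_exp us) \<le> D"
  unfolding sorted_exp_def by (intro depth_conj) auto

lemma depth_pow: "depth (pow_exp a l) \<le> depth a"
  by (induction l) auto

lemma depth_sum: "depth (sum_exp m q a) = q + depth a"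
proof -
  have "depth (foldr Sum us a) = length us + depth a" for us by (induction us) auto
  then show ?thesis by (simp add: sum_exp_def)
qed

section \<open>Deciding membership in the thinned families\<close>

locale pattern =
  fixes H :: "'a ugraph" and hs :: "'a list" and d :: nat
  assumes H: "simple_graph H" and hs: "distinct hs" "set hs = verts H" and d: "d = length hs"
begin

definition host_exp :: "nat list \<Rightarrow> exp" where
  "host_exp vs = disj_exp (map (\<lambda>ws. conj_exp
     (map (\<lambda>(i, j). neq_exp (ws ! i) (ws ! j)) (filter (\<lambda>(i, j). i < j) (List.product [0..<d] [0..<d])) @
      map (\<lambda>(i, j). adj_exp (ws ! i) (ws ! j))
        (filter (\<lambda>(i, j). {hs ! i, hs ! j} \<in> edges H) (List.product [0..<d] [0..<d]))))
     (List.n_lists d vs))"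

text \<open>The candidate set sits in the registers \<open>vs\<close>, and \<open>m\<close> is the
  first free one. Cores are unrolled as sublists of \<open>vs\<close>; the registers
  \<open>us\<close> run over the vertices added to a core. The test of the candidate itself may
  reuse registers from \<open>m\<close> on, whereas the test under the sum has to start beyond
  \<open>us\<close>.\<close>

primrec keep_exp :: "nat \<Rightarrow> nat \<Rightarrow> nat list \<Rightarrow> exp" where
  "keep_exp 0 m vs = host_exp vs"
| "keep_exp (Suc l) m vs = (let us = [m..<m + Suc l] in conj_exp (keep_exp l m vs #
     map (\<lambda>C. Op LessOp
         (sum_exp m (Suc l) (pos_exp (conj_exp
           [sorted_exp us, before_exp (C @ us) vs, keep_exp l (m + Suc l) (C @ us)])))
         (pow_exp (threshold_exp d) (Suc l)))
       (filter (\<lambda>C. length C = d - Suc l) (subseqs vs))))"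

lemma card_H: "card (verts H) = d"
  using hs d distinct_card by metis

lemma subseqs_subset: "C \<in> set (subseqs vs) \<Longrightarrow> set C \<subseteq> set vs"
  using subseqs_powset[of vs] by blast

lemma wf_host: "(\<And>v. v \<in> set vs \<Longrightarrow> v < m) \<Longrightarrow> 0 < m \<Longrightarrow> wf_exp m (host_exp vs)"
  unfolding host_exp_def wf_disj
proof (intro ballI)
  fix a assume m: "\<And>v. v \<in> set vs \<Longrightarrow> v < m" "0 < m"
    and "a \<in> set (map (\<lambda>ws. conj_exp
     (map (\<lambda>(i, j). neq_exp (ws ! i) (ws ! j)) (filter (\<lambda>(i, j). i < j) (List.product [0..<d] [0..<d])) @
      map (\<lambda>(i, j). adj_exp (ws ! i) (ws ! j))
        (filter (\<lambda>(i, j). {hs ! i, hs ! j} \<in> edges H) (List.product [0..<d] [0..<d]))))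
     (List.n_lists d vs))" (is "a \<in> set (map ?f _)")
  then obtain ws where ws: "ws \<in> set (List.n_lists d vs)" "a = ?f ws" by auto
  then have "set ws \<subseteq> set vs" "length ws = d" by (auto simp: set_n_lists)
  then have "ws ! i < m" if "i < d" for i
    using that m(1) by (metis nth_mem subsetD)
  then show "wf_exp m a" using m unfolding ws(2)
    by (auto simp: neq_exp_def adj_exp_def)
qed

lemma depth_host: "depth (host_exp vs) \<le> D"
  unfolding host_exp_def by (intro depth_disj) (auto intro!: depth_conj)

lemma wf_keep: "(\<And>v. v \<in> set vs \<Longrightarrow> v < m) \<Longrightarrow> 0 < m \<Longrightarrow> wf_exp m (keep_exp l m vs)"
proof (induction l arbitrary: m vs)
  case 0
  then show ?case by (simp add: wf_host)
next
  case (Suc l)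
  let ?us = "[m..<m + Suc l]"
  have "wf_exp m (sum_exp m (Suc l) (pos_exp (conj_exp
      [sorted_exp ?us, before_exp (C @ ?us) vs, keep_exp l (m + Suc l) (C @ ?us)])))"
    if "C \<in> set (subseqs vs)" for C
  proof (rule wf_sum)
    have C: "v < m" if "v \<in> set C" for v using subseqs_subset \<open>C \<in> _\<close> that Suc.prems by blast
    have "wf_exp (m + Suc l) (keep_exp l (m + Suc l) (C @ ?us))"
    proof (rule Suc.IH)
      show "v < m + Suc l" if "v \<in> set (C @ ?us)" for v
        using that C[of v] by auto
    qed simp
    moreover have "wf_exp (m + Suc l) (before_exp (C @ ?us) vs)"
    proof (rule wf_before)
      show "v < m + Suc l" if "v \<in> set (C @ ?us) \<union> set vs" for v
        using that C[of v] Suc.prems(1)[of v] by auto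
    qed
    moreover have "wf_exp (m + Suc l) (sorted_exp ?us)"
      by (auto simp: sorted_exp_def)
    ultimately show "wf_exp (m + Suc l) (pos_exp (conj_exp
      [sorted_exp ?us, before_exp (C @ ?us) vs, keep_exp l (m + Suc l) (C @ ?us)]))"
      by (simp add: pos_exp_def)
  qed
  moreover have "wf_exp m (pow_exp (threshold_exp d) (Suc l))"
    by (rule wf_pow) (simp add: threshold_exp_def)
  ultimately show ?case using Suc.IH[OF Suc.prems]
    by (simp add: Let_def del: upt_Suc pow_exp.simps)
qed

text \<open>The recursive call under the sum lies within \<open>Suc l\<close> loops, the one beside
  it enters only through a maximum. So level \<open>Suc l\<close> adds exactly \<open>Suc l\<close>
  to the bound.\<close>

lemma depth_keep: "depth (keep_exp l m vs) \<le> \<Sum>{..l}"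
proof (induction l arbitrary: m vs)
  case 0
  then show ?case using depth_host[of vs 0] by simp
next
  case (Suc l)
  let ?us = "[m..<m + Suc l]"
  have "depth (Op LessOp (sum_exp m (Suc l) (pos_exp (conj_exp
      [sorted_exp ?us, before_exp (C @ ?us) vs, keep_exp l (m + Suc l) (C @ ?us)])))
      (pow_exp (threshold_exp d) (Suc l))) \<le> \<Sum>{..Suc l}" for C
  proof -
    have "depth (conj_exp [sorted_exp ?us, before_exp (C @ ?us) vs, keep_exp l (m + Suc l) (C @ ?us)]) \<le> \<Sum>{..l}"
      by (rule depth_conj) (use depth_sorted depth_before Suc.IH in auto)
    moreover have "depth (pow_exp (threshold_exp d) (Suc l)) = 0"
      using depth_pow[of "threshold_exp d" "Suc l"] by (simp add: threshold_exp_def)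
    ultimately show ?thesis
      by (simp add: depth_sum pos_exp_def del: upt_Suc pow_exp.simps)
  qed
  moreover have "depth (keep_exp l m vs) \<le> \<Sum>{..Suc l}"
    using Suc.IH[of m vs] by simp
  ultimately show ?case
    unfolding keep_exp.simps Let_def by (intro depth_conj) (auto simp del: upt_Suc)
qed

end

lemma concat_if: "concat (map (\<lambda>u. if Q u then f u else []) xs) = concat (map f (filter Q xs))"
  by (induction xs) auto

section \<open>Correctness of the expressions\<close>

locale pattern_in_graph = pattern H hs d for H :: "'a ugraph" and hs d +
  fixes G :: "nat ugraph" and k n :: nat and t :: nat and x :: "nat list"
  assumes G: "G \<in> input_graphs" and n: "verts G = {..<n}"
    and x: "x = k # graph_code G" and t: "t = d * (k - 1) + 1"
begin

lemma sG: "simple_graph G"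
  using G by (simp add: input_graphs_def)

lemma holds_adj:
  assumes "s 0 = n" "s u < n" "s v < n"
  shows "holds x (adj_exp u v) s \<longleftrightarrow> {s u, s v} \<in> edges G"
proof -
  have "s u * n + s v < (s u + 1) * n" using assms by simp
  also have "\<dots> \<le> n * n" using assms by (intro mult_le_mono1) simp
  finally have less: "s u * n + s v < n * n" .
  have "(s u * n + s v) div n = s u" "(s u * n + s v) mod n = s v" using assms by auto
  then have "List.product [0..<n] [0..<n] ! (s u * n + s v) = (s u, s v)"
    using product_nth[of "s u * n + s v" "[0..<n]" "[0..<n]"] less assms by simp
  then show ?thesis
    using less assms by (simp add: adj_exp_def x graph_code_def n)
qed

lemma holds_host:
  assumes "s 0 = n" "\<And>v. v \<in> set vs \<Longrightarrow> s v < n" "length vs = d"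
  shows "holds x (host_exp vs) s \<longleftrightarrow> s ` set vs \<in> hosts H G"
proof -
  have 1: "holds x (host_exp vs) s \<longleftrightarrow> (\<exists>ws. length ws = d \<and> set ws \<subseteq> set vs \<and>
     (\<forall>i<d. \<forall>j<d. i < j \<longrightarrow> s (ws ! i) \<noteq> s (ws ! j)) \<and>
     (\<forall>i<d. \<forall>j<d. {hs ! i, hs ! j} \<in> edges H \<longrightarrow> {s (ws ! i), s (ws ! j)} \<in> edges G))"
    (is "_ \<longleftrightarrow> ?ex")
  proof -
    have adj: "holds x (adj_exp (ws ! i) (ws ! j)) s \<longleftrightarrow> {s (ws ! i), s (ws ! j)} \<in> edges G"
      if "length ws = d" "set ws \<subseteq> set vs" "i < d" "j < d" for ws i j
      using that assms by (intro holds_adj) (meson nth_mem subsetD)+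
    show ?thesis
      unfolding host_exp_def holds_disj
      by (auto simp: set_n_lists ball_Un adj)
  qed
  show ?thesis unfolding 1
  proof
    assume ?ex
    then obtain ws where ws: "length ws = d" "set ws \<subseteq> set vs"
      "\<forall>i<d. \<forall>j<d. i < j \<longrightarrow> s (ws ! i) \<noteq> s (ws ! j)"
      "\<forall>i<d. \<forall>j<d. {hs ! i, hs ! j} \<in> edges H \<longrightarrow> {s (ws ! i), s (ws ! j)} \<in> edges G" by blast
    define w where "w i = s (ws ! i)" for i
    have inj: "inj_on w {..<d}"
      by (rule linorder_inj_onI') (use ws(3) in \<open>auto simp: w_def\<close>)
    have "card (s ` set vs) \<le> d"
      using card_image_le[of "set vs" s] card_length[of vs] assms(3) by simp
    moreover have "w ` {..<d} \<subseteq> s ` set vs"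
      using ws(1,2) unfolding w_def by (auto intro!: imageI dest: nth_mem)
    moreover have "card (w ` {..<d}) = d" using inj by (simp add: card_image)
    \<comment> \<open>\<open>host_exp\<close> demands injectivity only; \<open>d\<close> different
      values in a set of at most \<open>d\<close> elements exhaust it.\<close>
    ultimately have "w ` {..<d} = s ` set vs" by (intro card_seteq) auto
    then have bw: "bij_betw w {..<d} (s ` set vs)" using inj by (simp add: bij_betw_def)
    have bh: "bij_betw ((!) hs) {..<d} (verts H)"
      using hs d by (intro bij_betw_nth) auto
    define g where "g = w \<circ> the_inv_into {..<d} ((!) hs)"
    have g: "g (hs ! i) = w i" if "i < d" for i
      using that bh by (simp add: g_def bij_betw_def the_inv_into_f_f)
    have "bij_betw g (verts H) (s ` set vs)"
      unfolding g_def by (rule bij_betw_trans[OF bij_betw_the_inv_into[OF bh] bw])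
    moreover have "g ` e \<in> edges G" if e: "e \<in> edges H" for e
    proof -
      have "card e = 2" "e \<subseteq> verts H" using H e by (auto simp: simple_graph_def)
      then obtain a b where ab: "e = {a, b}" "a \<in> set hs" "b \<in> set hs"
        using hs(2) by (auto simp: card_2_iff)
      then obtain i j where "i < d" "j < d" "a = hs ! i" "b = hs ! j"
        using d by (auto simp: in_set_conv_nth)
      then show ?thesis using ab(1) e ws(4) g by (auto simp: w_def)
    qed
    moreover have "s ` set vs \<subseteq> verts G" using assms(2) n by auto
    ultimately show "s ` set vs \<in> hosts H G" by (auto simp: hosts_def)
  next
    assume "s ` set vs \<in> hosts H G"
    then obtain g where g: "bij_betw g (verts H) (s ` set vs)" "\<forall>e\<in>edges H. g ` e \<in> edges G"
      by (auto simp: hosts_def)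
    have "\<forall>h\<in>verts H. \<exists>v\<in>set vs. s v = g h" using g(1) by (force simp: bij_betw_def)
    then obtain p where p: "\<forall>h\<in>verts H. p h \<in> set vs \<and> s (p h) = g h" by metis
    have hi: "hs ! i \<in> verts H" if "i < d" for i using that d hs(2) by (metis nth_mem)
    show ?ex
    proof (intro exI[of _ "map p hs"] conjI allI impI)
      show "set (map p hs) \<subseteq> set vs" using p hs(2) by auto
      fix i j assume ij: "i < d" "j < d"
      have s: "s (map p hs ! i) = g (hs ! i)" "s (map p hs ! j) = g (hs ! j)"
        using ij d p hi by auto
      {
        assume "i < j"
        then have "hs ! i \<noteq> hs ! j" using hs(1) ij d by (simp add: nth_eq_iff_index_eq)
        then show "s (map p hs ! i) \<noteq> s (map p hs ! j)"
          using s g(1) hi ij by (auto simp: bij_betw_def inj_on_eq_iff)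
      }
      assume "{hs ! i, hs ! j} \<in> edges H"
      then have "g ` {hs ! i, hs ! j} \<in> edges G" using g(2) by blast
      then show "{s (map p hs ! i), s (map p hs ! j)} \<in> edges G"
        unfolding s by simp
    qed (simp add: d)
  qed
qed

lemma eval_threshold_t: "eval x (threshold_exp d) s = t"
  unfolding x t by (rule eval_threshold)

abbreviation kept :: "nat \<Rightarrow> nat set set" where
  "kept l \<equiv> thin d t (hosts H G) l"

lemma kept_card: "f \<in> kept l \<Longrightarrow> f \<subseteq> {..<n} \<and> card f = d"
  using thin_subset[of d t "hosts H G" l] hosts_card[OF sG, of f H] n card_H
  by (auto simp: hosts_def)

text \<open>Stated for arbitrary \<open>m\<close>, \<open>vs\<close> and \<open>s\<close>, since the
  recursive call under the sum concerns a core extended by loop registers, in a store where these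
  have been assigned.\<close>

lemma holds_keep:
  assumes "s 0 = n" "\<And>v. v \<in> set vs \<Longrightarrow> v < m \<and> s v < n" "length vs = d" "l \<le> d" "0 < m"
  shows "holds x (keep_exp l m vs) s \<longleftrightarrow> s ` set vs \<in> kept l"
  using assms
proof (induction l arbitrary: m vs s)
  case 0
  then show ?case using holds_host[of s vs] by simp
next
  case (Suc l)
  let ?f = "s ` set vs"
  let ?us = "[m..<m + Suc l]"
  have IH: "holds x (keep_exp l m vs) s \<longleftrightarrow> ?f \<in> kept l"
    by (rule Suc.IH) (use Suc.prems in auto)
  show ?case
  \<comment> \<open>If not, the first conjunct fails. If so, \<open>?f\<close> has \<open>d\<close>
    elements, hence the registers \<open>vs\<close> hold different values and their sublists match
    the subsets of \<open>?f\<close>.\<close>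
  proof (cases "?f \<in> kept l")
    case False
    then show ?thesis using IH by (simp add: Let_def del: upt_Suc)
  next
    case True
    have cf: "card ?f = d" using kept_card True by blast
    have cvs: "card (set vs) = d"
      using card_image_le[of "set vs" s] card_length[of vs] cf Suc.prems(3) by simp
    have inj: "inj_on s (set vs)" using cf cvs by (simp add: eq_card_imp_inj_on)
    have dist: "distinct vs" using cvs Suc.prems(3) by (simp add: card_distinct)
    have count: "eval x (sum_exp m (Suc l) (pos_exp (conj_exp
        [sorted_exp ?us, before_exp (C @ ?us) vs, keep_exp l (m + Suc l) (C @ ?us)]))) s =
      card {f' \<in> kept l. s ` set C \<subseteq> f' \<and> set_encode f' < set_encode ?f}" (is "?E = _")
      if C: "C \<in> set (subseqs vs)" "length C = d - Suc l" for C
    proof -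
      have Cvs: "set C \<subseteq> set vs" using C subseqs_subset by blast
      have "distinct C" using C dist subseqs_distinctD by blast
      then have cC: "card (s ` set C) = d - Suc l"
        using inj Cvs C(2) by (simp add: card_image inj_on_subset distinct_card)
      let ?W = "{ws. length ws = Suc l \<and> set ws \<subseteq> {..<n}}"
      have "holds x (conj_exp [sorted_exp ?us, before_exp (C @ ?us) vs, keep_exp l (m + Suc l) (C @ ?us)])
          (assign m ws s) \<longleftrightarrow> sorted_wrt (<) ws \<and> s ` set C \<union> set ws \<in>
            {f' \<in> kept l. set_encode f' < set_encode ?f}" if "ws \<in> ?W" for ws
      proof -
        let ?s = "assign m ws s"
        have ws: "length ws = Suc l" "set ws \<subseteq> {..<n}" using that by auto
        have old: "?s v = s v" if "v < m" for v using that by (simp add: assign_def)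
        have new: "?s (m + i) = ws ! i" if "i < Suc l" for i using that ws by (simp add: assign_def)
        have us: "set ?us = (\<lambda>i. m + i) ` {..<Suc l}"
          by (simp add: lessThan_atLeast0 image_add_atLeastLessThan add.commute[of _ m] del: upt_Suc)
        have im_us: "?s ` set ?us = set ws"
        proof -
          have "?s ` set ?us = (\<lambda>i. ws ! i) ` {..<Suc l}"
            unfolding us image_image by (rule image_cong) (use new in auto)
          then show ?thesis using ws(1) by (auto simp: set_conv_nth)
        qed
        have im_vs: "?s ` set vs = ?f" "?s ` set C = s ` set C"
          using old Suc.prems(2) Cvs by (auto intro!: image_cong)
        have im_Cus: "?s ` set (C @ ?us) = s ` set C \<union> set ws"
          by (simp only: set_append image_Un im_us im_vs)
        have "holds x (keep_exp l (m + Suc l) (C @ ?us)) ?s \<longleftrightarrow> ?s ` set (C @ ?us) \<in> kept l"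
        proof (rule Suc.IH)
          show "?s 0 = n" using old Suc.prems by simp
          show "v < m + Suc l \<and> ?s v < n" if "v \<in> set (C @ ?us)" for v
          proof (cases "v \<in> set C")
            case True
            then show ?thesis using old Cvs Suc.prems(2)[of v] by auto
          next
            case False
            then have v: "v \<in> set ?us" using that by simp
            then have "?s v \<in> set ws" using im_us by blast
            then show ?thesis using v ws(2) by auto
          qed
          show "length (C @ ?us) = d" using C(2) Suc.prems(4) by simp
        qed (use Suc.prems in auto)
        moreover have "holds x (sorted_exp ?us) ?s \<longleftrightarrow> sorted_wrt (<) ws"
          unfolding holds_sorted us using new ws(1)
          by (auto simp: sorted_wrt_iff_nth_less)
        ultimately show ?thesis
          by (simp only: holds_conj list.set ball_simps holds_before im_Cus im_vs) auto
      qed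
      then have "?E = (\<Sum>ws\<in>?W. of_bool (sorted_wrt (<) ws \<and> s ` set C \<union> set ws \<in>
            {f' \<in> kept l. set_encode f' < set_encode ?f}))"
        unfolding eval_sum_exp[OF Suc.prems(5)] Suc.prems(1) eval_pos
        by (intro sum.cong[OF refl]) simp
      also have "\<dots> = card (?W \<inter> {ws. sorted_wrt (<) ws \<and> s ` set C \<union> set ws \<in>
            {f' \<in> kept l. set_encode f' < set_encode ?f}})"
        using finite_lists_length by (simp add: sum.If_cases of_bool_def)
      also have "?W \<inter> {ws. sorted_wrt (<) ws \<and> s ` set C \<union> set ws \<in>
            {f' \<in> kept l. set_encode f' < set_encode ?f}} =
         {ws. length ws = Suc l \<and> set ws \<subseteq> {..<n} \<and> sorted_wrt (<) ws \<and> s ` set C \<union> set ws \<in>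
            {f' \<in> kept l. set_encode f' < set_encode ?f}}" by auto
      also have "card \<dots> = card {f' \<in> {f' \<in> kept l. set_encode f' < set_encode ?f}. s ` set C \<subseteq> f'}"
      proof (rule card_sorted_lists[where d = d])
        show "{f' \<in> kept l. set_encode f' < set_encode ?f} \<subseteq> {f. f \<subseteq> {..<n} \<and> card f = d}"
          using kept_card by blast
      qed (use cC Suc.prems(4) in auto)
      also have "{f' \<in> {f' \<in> kept l. set_encode f' < set_encode ?f}. s ` set C \<subseteq> f'} =
        {f' \<in> kept l. s ` set C \<subseteq> f' \<and> set_encode f' < set_encode ?f}" by auto
      finally show ?thesis .
    qed
    have "holds x (keep_exp (Suc l) m vs) s \<longleftrightarrow>
      (\<forall>C\<in>set (subseqs vs). length C = d - Suc l \<longrightarrow>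
        card {f' \<in> kept l. s ` set C \<subseteq> f' \<and> set_encode f' < set_encode ?f} < t ^ Suc l)"
      using True IH count
      by (simp add: Let_def eval_threshold_t del: upt_Suc pow_exp.simps power_Suc) blast
    \<comment> \<open>From sublists of registers to sets of vertices: injectivity of
      \<open>s\<close> on \<open>set vs\<close> makes the length of a sublist equal to the size of
      its image.\<close>
    also have "\<dots> \<longleftrightarrow> (\<forall>C\<subseteq>?f. card C = d - Suc l \<longrightarrow>
        card {f' \<in> kept l. C \<subseteq> f' \<and> set_encode f' < set_encode ?f} < t ^ Suc l)"
    proof (intro iffI allI ballI impI)
      fix C assume small: "\<forall>C\<in>set (subseqs vs). length C = d - Suc l \<longrightarrow>
        card {f' \<in> kept l. s ` set C \<subseteq> f' \<and> set_encode f' < set_encode ?f} < t ^ Suc l"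
        and C: "C \<subseteq> ?f" "card C = d - Suc l"
      obtain V where V: "V \<subseteq> set vs" "C = s ` V" using C(1) by (auto simp: subset_image_iff)
      then obtain C' where C': "C' \<in> set (subseqs vs)" "set C' = V"
        using subset_subseqs[of V vs] by auto
      have "length C' = card V" using subseqs_distinctD[OF C'(1) dist] C'(2) distinct_card by metis
      also have "\<dots> = card C" using V inj by (metis card_image inj_on_subset)
      finally show "card {f' \<in> kept l. C \<subseteq> f' \<and> set_encode f' < set_encode ?f} < t ^ Suc l"
        using small C' V(2) C(2) by auto
    next
      fix C assume small: "\<forall>C\<subseteq>?f. card C = d - Suc l \<longrightarrow>
        card {f' \<in> kept l. C \<subseteq> f' \<and> set_encode f' < set_encode ?f} < t ^ Suc l"
        and C: "C \<in> set (subseqs vs)" "length C = d - Suc l"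
      have "set C \<subseteq> set vs" using C subseqs_subset by blast
      moreover have "card (s ` set C) = d - Suc l"
        using subseqs_distinctD[OF C(1) dist] calculation inj C(2)
        by (simp add: card_image inj_on_subset distinct_card)
      ultimately show "card {f' \<in> kept l. s ` set C \<subseteq> f' \<and> set_encode f' < set_encode ?f} < t ^ Suc l"
        using small by blast
    qed
    finally show ?thesis using True by simp
  qed
qed

text \<open>Only existence is asked for, so several tuples for one set do no harm and no order is
  imposed. Different values on \<open>C\<close> ensure that the rest of a set has exactly
  \<open>q\<close> elements and fits into the new registers.\<close>

lemma holds_ex_keep:
  assumes "s 0 = n" "\<And>v. v \<in> set C \<Longrightarrow> v < m \<and> s v < n" "0 < m" "length C + q = d" "distinct C" "inj_on s (set C)"
  shows "holds x (sum_exp m q (keep_exp d (m + q) (C @ [m..<m + q]))) s \<longleftrightarrow>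
    (\<exists>f\<in>kept d. s ` set C \<subseteq> f)"
proof -
  let ?us = "[m..<m + q]"
  let ?W = "{ws. length ws = q \<and> set ws \<subseteq> {..<n}}"
  have "holds x (keep_exp d (m + q) (C @ ?us)) (assign m ws s) \<longleftrightarrow> s ` set C \<union> set ws \<in> kept d"
    if "ws \<in> ?W" for ws
  proof -
    let ?s = "assign m ws s"
    have ws: "length ws = q" "set ws \<subseteq> {..<n}" using that by auto
    have old: "?s v = s v" if "v < m" for v using that by (simp add: assign_def)
    have us: "set ?us = (\<lambda>i. m + i) ` {..<q}"
      by (simp add: lessThan_atLeast0 image_add_atLeastLessThan add.commute[of _ m] del: upt_Suc)
    have im_us: "?s ` set ?us = set ws"
    proof -
      have "?s ` set ?us = (\<lambda>i. ws ! i) ` {..<q}"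
        unfolding us image_image by (rule image_cong) (use ws in \<open>auto simp: assign_def\<close>)
      then show ?thesis using ws(1) by (auto simp: set_conv_nth)
    qed
    have im_C: "?s ` set C = s ` set C"
      using old assms(2) by (auto intro!: image_cong)
    have "holds x (keep_exp d (m + q) (C @ ?us)) ?s \<longleftrightarrow> ?s ` set (C @ ?us) \<in> kept d"
    proof (rule holds_keep)
      show "?s 0 = n" using old assms by simp
      show "v < m + q \<and> ?s v < n" if "v \<in> set (C @ ?us)" for v
      proof (cases "v \<in> set C")
        case True
        then show ?thesis using old assms(2)[of v] by auto
      next
        case False
        then have v: "v \<in> set ?us" using that by simp
        then have "?s v \<in> set ws" using im_us by blast
        then show ?thesis using v ws(2) by auto
      qed
    qed (use assms in auto)
    then show ?thesis by (simp only: set_append image_Un im_us im_C)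
  qed
  then have "holds x (sum_exp m q (keep_exp d (m + q) (C @ ?us))) s \<longleftrightarrow>
    (\<exists>ws\<in>?W. s ` set C \<union> set ws \<in> kept d)"
    unfolding eval_sum_exp[OF assms(3)] assms(1) using finite_lists_length[of q n]
    by (subst neq0_conv[symmetric]) (auto simp: sum_eq_0_iff)
  also have "\<dots> \<longleftrightarrow> (\<exists>f\<in>kept d. s ` set C \<subseteq> f)"
  proof
    assume "\<exists>f\<in>kept d. s ` set C \<subseteq> f"
    then obtain f where f: "f \<in> kept d" "s ` set C \<subseteq> f" by blast
    have fn: "f \<subseteq> {..<n}" "card f = d" using kept_card f(1) by auto
    then have fin: "finite f" using finite_subset by blast
    have "card (s ` set C) = length C" using assms(5,6) by (simp add: card_image distinct_card)
    then have "card (f - s ` set C) = q" using f(2) fn(2) assms(4) by (simp add: card_Diff_subset)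
    then have "sorted_list_of_set (f - s ` set C) \<in> ?W" using fin fn by auto
    moreover have "s ` set C \<union> set (sorted_list_of_set (f - s ` set C)) = f" using f fin by auto
    ultimately show "\<exists>ws\<in>?W. s ` set C \<union> set ws \<in> kept d" using f(1) by (metis (no_types, lifting))
  qed auto
  finally show ?thesis .
qed

end

section \<open>The output routine\<close>

context pattern begin

definition vertex_exp :: "nat \<Rightarrow> nat \<Rightarrow> exp" where
  "vertex_exp v m = sum_exp m (d - 1) (keep_exp d (m + (d - 1)) ([v] @ [m..<m + (d - 1)]))"

text \<open>The sum is meaningful only for two different vertices. On the diagonal the adjacency
  factor is 0, so the product is correct there too.\<close>

definition entry_exp :: exp where
  "entry_exp = pos_exp (Op TimesOp (adj_exp 1 2)
     (sum_exp 3 (d - 2) (keep_exp d (3 + (d - 2)) ([1, 2] @ [3..<3 + (d - 2)]))))"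

definition kernel_stm :: stm where
  "kernel_stm = Sq (Wr (Rd (N 0))) (Sq (Wr (Sum 1 (pos_exp (vertex_exp 1 2))))
     (For 1 (If (vertex_exp 1 2) (For 2 (If (vertex_exp 2 3) (Wr entry_exp))))))"

lemma wf_vertex: "v < m \<Longrightarrow> wf_exp m (vertex_exp v m)"
  unfolding vertex_exp_def by (intro wf_sum wf_keep) auto

lemma wf_kernel: "wf_stm 1 kernel_stm"
proof -
  have "wf_exp 3 (sum_exp 3 (d - 2) (keep_exp d (3 + (d - 2)) ([1, 2] @ [3..<3 + (d - 2)])))"
    by (intro wf_sum wf_keep) auto
  then have "wf_exp 3 entry_exp" by (simp add: entry_exp_def adj_exp_def pos_exp_def)
  then show ?thesis
    using wf_vertex[of 1 2] wf_vertex[of 2 3]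
    by (simp add: kernel_stm_def pos_exp_def numeral_2_eq_2 numeral_3_eq_3)
qed

lemma depth_vertex: "depth (vertex_exp v m) \<le> d - 1 + \<Sum>{..d}"
  unfolding vertex_exp_def depth_sum using depth_keep by simp

text \<open>The deepest nest has the two output loops, the \<open>d - 1\<close> loops of
  \<open>vertex_exp 2 3\<close> and those of \<open>keep_exp d\<close>, which number at most
  \<open>d * (d + 1) / 2\<close>. Another \<open>d + 1\<close> loops fit below
  \<open>d * (d + 1)\<close> exactly when \<open>2 \<le> d\<close>.\<close>

lemma depth_kernel:
  assumes "2 \<le> d"
  shows "stm_depth kernel_stm \<le> d * (d + 1)"
proof -
  have sum: "2 * \<Sum>{..d} = d * (d + 1)" by (induction d) auto
  have "2 * (d + 1) \<le> d * (d + 1)" using assms by (rule mult_le_mono1)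
  moreover have "a + b \<le> c" if "2 * a \<le> c" "2 * b = c" for a b c :: nat using that by linarith
  ultimately have "d + 1 + \<Sum>{..d} \<le> d * (d + 1)" using sum by blast
  moreover have "depth entry_exp \<le> d - 2 + \<Sum>{..d}"
    unfolding entry_exp_def pos_exp_def using depth_keep by (simp add: depth_sum)
  moreover note depth_vertex[of 1 2] depth_vertex[of 2 3]
  ultimately show ?thesis using assms by (simp add: kernel_stm_def pos_exp_def)
qed

end

text \<open>Both loops skip the vertices outside \<open>\<Union>F\<close>, so what remains of the
  matrix is indexed by \<open>L\<close> in increasing order, as \<open>relabelled_code\<close>
  requires.\<close>

lemma (in pattern_in_graph) out_kernel:
  assumes "2 \<le> d"
  defines "F \<equiv> thin d t (hosts H G) d"
  defines "L \<equiv> filter (\<lambda>v. v \<in> \<Union>F) [0..<n]"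
  shows "out x kernel_stm ((\<lambda>_. 0)(0 := n)) = k # graph_code (relabelled G F L)"
proof -
  let ?s = "(\<lambda>_. 0)(0 := n) :: store"
  have F: "F \<subseteq> hosts H G" unfolding F_def by (rule thin_subset)
  have "\<Union>F \<subseteq> {..<n}" using kept_card unfolding F_def by blast
  then have L: "distinct L" "set L = \<Union>F" by (auto simp: L_def)
  have vert: "holds x (vertex_exp v m) s \<longleftrightarrow> s v \<in> \<Union>F" if "s 0 = n" "v < m" "s v < n" for s v m
    unfolding vertex_exp_def F_def using holds_ex_keep[of s "[v]" m "d - 1"] that assms(1) by auto
  have entry: "eval x entry_exp (?s(1 := u, 2 := v)) = of_bool (spanned G F u v)"
    if "u < n" "v < n" for u v
  proof -
    let ?s = "?s(1 := u, 2 := v)"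
    have adj: "holds x (adj_exp 1 2) ?s \<longleftrightarrow> {u, v} \<in> edges G" using holds_adj[of ?s 1 2] that by simp
    have "holds x (sum_exp 3 (d - 2) (keep_exp d (3 + (d - 2)) ([1, 2] @ [3..<3 + (d - 2)]))) ?s \<longleftrightarrow>
        (\<exists>f\<in>F. u \<in> f \<and> v \<in> f)" if "u \<noteq> v"
    proof -
      have "inj_on ?s (set [1, 2])" using \<open>u \<noteq> v\<close> by (simp add: inj_on_def)
      then have "holds x (sum_exp 3 (d - 2) (keep_exp d (3 + (d - 2)) ([1, 2] @ [3..<3 + (d - 2)]))) ?s \<longleftrightarrow>
          (\<exists>f\<in>F. ?s ` set [1, 2] \<subseteq> f)"
        unfolding F_def using \<open>u < n\<close> \<open>v < n\<close> assms(1)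
        by (intro holds_ex_keep) (simp_all del: upt_Suc, auto)
      moreover have "?s ` set [1, 2] = {u, v}" by simp
      ultimately show ?thesis by (simp only: insert_subset empty_subsetI simp_thms)
    qed
    moreover have "u \<noteq> v" if "{u, v} \<in> edges G"
      using that sG by (auto simp: simple_graph_def)
    ultimately show ?thesis
      using adj unfolding entry_exp_def spanned_def by auto
  qed
  let ?inner = "If (vertex_exp 2 3) (Wr entry_exp)"
  let ?outer = "If (vertex_exp 1 2) (For 2 ?inner)"
  have row: "out x (For 2 ?inner) (?s(1 := u)) = map (\<lambda>v. of_bool (spanned G F u v)) L"
    if u: "u < n" for u
  proof -
    have "out x ?inner (?s(1 := u, 2 := v)) =
        (if v \<in> \<Union>F then [of_bool (spanned G F u v)] else [])" if "v < n" for v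
      using vert[of "?s(1 := u, 2 := v)" 2 3] entry[OF u that] that by simp
    then have "map (\<lambda>v. out x ?inner (?s(1 := u, 2 := v))) [0..<n] =
        map (\<lambda>v. if v \<in> \<Union>F then [of_bool (spanned G F u v)] else []) [0..<n]"
      by (intro map_cong[OF refl]) (simp only: set_upt atLeastLessThan_iff)
    moreover have "out x (For 2 ?inner) (?s(1 := u)) =
        concat (map (\<lambda>v. out x ?inner (?s(1 := u, 2 := v))) [0..<n])"
      by (subst out.simps(4)) (simp only: fun_upd_apply one_neq_zero zero_neq_one simp_thms if_True if_False)
    ultimately have "out x (For 2 ?inner) (?s(1 := u)) =
        concat (map (\<lambda>v. if v \<in> \<Union>F then [of_bool (spanned G F u v)] else []) [0..<n])"
      by (simp only:)
    then show ?thesis by (simp only: concat_if concat_map_singleton L_def)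
  qed
  have "out x ?outer (?s(1 := u)) =
     (if u \<in> \<Union>F then map (\<lambda>v. of_bool (spanned G F u v)) L else [])" if "u < n" for u
  proof -
    have "holds x (vertex_exp 1 2) (?s(1 := u)) \<longleftrightarrow> u \<in> \<Union>F"
      using vert[of "?s(1 := u)" 1 2] that by simp
    then show ?thesis by (subst out.simps(3)) (simp only: row[OF that])
  qed
  then have "map (\<lambda>u. out x ?outer (?s(1 := u))) [0..<n] =
      map (\<lambda>u. if u \<in> \<Union>F then map (\<lambda>v. of_bool (spanned G F u v)) L else []) [0..<n]"
    by (intro map_cong[OF refl]) (simp only: set_upt atLeastLessThan_iff)
  moreover have "out x (For 1 ?outer) ?s = concat (map (\<lambda>u. out x ?outer (?s(1 := u))) [0..<n])"
    by (subst out.simps(4)) (simp only: fun_upd_same)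
  ultimately have "out x (For 1 ?outer) ?s =
      concat (map (\<lambda>u. if u \<in> \<Union>F then map (\<lambda>v. of_bool (spanned G F u v)) L else []) [0..<n])"
    by (simp only:)
  also have "\<dots> = concat (map (\<lambda>u. map (\<lambda>v. of_bool (spanned G F u v)) L) L)"
    by (simp only: concat_if L_def)
  also have "\<dots> = map (\<lambda>(u, v). of_bool (spanned G F u v)) (List.product L L)"
    by (simp add: product_concat_map map_concat comp_def)
  finally have matrix: "out x (For 1 ?outer) ?s =
     map (\<lambda>(u, v). of_bool (spanned G F u v)) (List.product L L)" .
  have "eval x (Sum 1 (pos_exp (vertex_exp 1 2))) ?s = (\<Sum>u<n. of_bool (u \<in> \<Union>F))"
    unfolding eval.simps fun_upd_same eval_pos
  proof (rule sum.cong[OF refl])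
    fix u assume "u \<in> {..<n}"
    then show "of_bool (holds x (vertex_exp 1 2) (?s(1 := u))) = of_bool (u \<in> \<Union>F)"
      using vert[of "?s(1 := u)" 1 2] by simp
  qed
  also have "\<dots> = card ({..<n} \<inter> {u. u \<in> \<Union>F})" by (simp add: sum.If_cases of_bool_def)
  also have "{..<n} \<inter> {u. u \<in> \<Union>F} = set L" by (auto simp: L_def)
  also have "card (set L) = length L" by (rule distinct_card[OF L(1)])
  finally have "eval x (Sum 1 (pos_exp (vertex_exp 1 2))) ?s = length L" .
  then show ?thesis
    unfolding kernel_stm_def relabelled_code[OF H sG F L] out.simps(2) matrix
    by (simp add: x)
qed

text \<open>The vertex bound is recorded because the code length depends on the vertices, not on the
  edges. \<open>k' \<le> k + 1\<close> covers both the unchanged parameter and the parameter 0 or 1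
  of the trivial kernel.\<close>

definition kernelizes :: "'a ugraph \<Rightarrow> stm \<Rightarrow> nat ugraph \<Rightarrow> nat \<Rightarrow> nat ugraph \<Rightarrow> nat \<Rightarrow> bool" where
  "kernelizes H c G k G' k' \<longleftrightarrow> (let d = card (verts H) in
     out (k # graph_code G) c ((\<lambda>_. 0)(0 := card (verts G))) = k' # graph_code G' \<and>
     ((G, k) \<in> H_packing H \<longleftrightarrow> (G', k') \<in> H_packing H) \<and>
     card (edges G') \<le> d * (d - 1) div 2 * (d * (k - 1) + 1) ^ d \<and>
     card (verts G') \<le> d * (d * k + 1) ^ d \<and> k' \<le> k + 1)"

lemma (in pattern_in_graph) kernelizes_kernel:
  assumes "2 \<le> d"
  shows "\<exists>G'\<in>input_graphs. \<exists>k'. kernelizes H kernel_stm G k G' k'"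
proof -
  define F where "F = thin d t (hosts H G) d"
  define L where "L = filter (\<lambda>v. v \<in> \<Union>F) [0..<n]"
  let ?G = "relabelled G F L"
  have F: "F \<subseteq> hosts H G" unfolding F_def by (rule thin_subset)
  have "\<Union>F \<subseteq> {..<n}" using kept_card unfolding F_def by blast
  then have L: "distinct L" "set L = \<Union>F" by (auto simp: L_def)
  have hosts: "finite (hosts H G)" "\<And>f. f \<in> hosts H G \<Longrightarrow> finite f \<and> card f = d"
    using finite_hosts[OF sG, of H] hosts_card[OF sG, of _ H] card_H by simp_all
  \<comment> \<open>At level \<open>d\<close> the cores have size 0, and the bound for the empty
    core counts the whole family.\<close>
  have "card {f \<in> F. {} \<subseteq> f} \<le> t ^ d" unfolding F_def
    by (rule card_thin_le[OF hosts]) auto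
  then have cF: "card F \<le> t ^ d" by simp
  have "card (edges ?G) \<le> d * (d - 1) div 2 * card F"
    using relabelled_card_edges[OF H sG F L] card_H by simp
  also have "\<dots> \<le> d * (d - 1) div 2 * t ^ d" using cF by simp
  finally have e: "card (edges ?G) \<le> d * (d - 1) div 2 * t ^ d" .
  have "card (verts ?G) = length L" by (simp add: relabelled_def)
  also have "\<dots> \<le> d * card F" using relabelled_length[OF H sG F L] card_H by simp
  also have "\<dots> \<le> d * t ^ d" using cF by simp
  also have "\<dots> \<le> d * (d * k + 1) ^ d" unfolding t by (intro mult_le_mono2 power_mono) auto
  finally have v: "card (verts ?G) \<le> d * (d * k + 1) ^ d" .
  have "(?G, k) \<in> H_packing H \<longleftrightarrow> (G, k) \<in> H_packing H"
  proof (rule relabelled_packing[OF H sG F L])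
    show "0 < card (verts H)" using card_H assms by simp
    fix P assume "P \<subseteq> hosts H G" "finite P" "card P = k" "disjoint P"
    then show "\<exists>P' \<subseteq> F. finite P' \<and> card P' = k \<and> disjoint P'"
      unfolding F_def using packing_thin[OF hosts t] by blast
  qed
  moreover have "out x kernel_stm ((\<lambda>_. 0)(0 := n)) = k # graph_code ?G"
    using out_kernel[OF assms] by (simp add: F_def L_def)
  ultimately have "kernelizes H kernel_stm G k ?G k"
    unfolding kernelizes_def Let_def card_H using e v by (simp add: n x t)
  then show ?thesis using relabelled_input[OF H sG F L] by blast
qed

text \<open>For \<open>d \<le> 1\<close> the output loops of the general program are too slow, but the answer can be read
  off \<open>n\<close> and \<open>k\<close>; the output is the empty graph with parameter 0 or 1.\<close>

definition trivial_stm :: "nat \<Rightarrow> stm" where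
  "trivial_stm d = Sq (Wr (Op LessOp (V 0) (Op TimesOp (N d) (Rd (N 0))))) (Wr (N 0))"

lemma kernelizes_trivial:
  assumes H: "simple_graph H" and d: "card (verts H) \<le> 1" and G: "G \<in> input_graphs"
  shows "\<exists>G'\<in>input_graphs. \<exists>k'. kernelizes H (trivial_stm (card (verts H))) G k G' k'"
proof -
  define d where "d = card (verts H)"
  obtain n where n: "verts G = {..<n}" using G by (auto simp: input_graphs_def)
  have sG: "simple_graph G" using G by (simp add: input_graphs_def)
  let ?E = "({}, {}) :: nat ugraph"
  have E: "?E \<in> input_graphs" by (auto simp: input_graphs_def simple_graph_def)
  then have sE: "simple_graph ?E" by (simp add: input_graphs_def)
  have no_edges: "edges H = {}"
  proof -
    have "card e < 2" if "e \<subseteq> verts H" for e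
      using card_mono[OF _ that] H d by (simp add: simple_graph_def)
    moreover have "e \<subseteq> verts H \<and> card e = 2" if "e \<in> edges H" for e
      using H that by (auto simp: simple_graph_def)
    ultimately show ?thesis by (metis all_not_in_conv less_irrefl)
  qed
  \<comment> \<open>The empty pattern can always be packed, and then the test \<open>n < 0\<close>
    yields parameter 0. A single vertex can be packed \<open>k\<close> times iff
    \<open>k \<le> n\<close>; otherwise the parameter is 1, and the empty graph contains no
    copy.\<close>
  have "(G, k) \<in> H_packing H \<longleftrightarrow> (?E, of_bool (n < d * k)) \<in> H_packing H"
  proof (cases "d = 0")
    case True
    then have "verts H = {}" using H by (simp add: d_def simple_graph_def)
    then have "occurrence H ?E G"
      using no_edges by (auto simp: occurrence_def subgraph_def simple_graph_def isomorphic_def bij_betw_def)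
    then have "(G, k) \<in> H_packing H" by (auto simp: H_packing_def intro!: exI[of _ "\<lambda>_. ?E"])
    then show ?thesis using True by (simp add: H_packing_def)
  next
    case False
    then have d1: "d = 1" using d d_def by simp
    have hosts_le: "\<exists>v. f = {v} \<and> v < n" if "f \<in> hosts H G" for f
      using hosts_card[OF sG that] that d1 n by (auto simp: d_def card_1_singleton_iff hosts_def)
    have in_hosts: "{v} \<in> hosts H G" if "v < n" for v
    proof -
      obtain a where "verts H = {a}" using d1 by (auto simp: d_def card_1_singleton_iff)
      then have "bij_betw (\<lambda>_. v) (verts H) {v}" by (auto simp: bij_betw_def)
      then show ?thesis using that n no_edges by (auto simp: hosts_def)
    qed
    have pos: "0 < card (verts H)" using d1 d_def by simp
    have "(G, k) \<in> H_packing H \<longleftrightarrow> k \<le> n"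
      unfolding H_packing_iff[OF H sG pos]
    proof
      assume "\<exists>P \<subseteq> hosts H G. finite P \<and> card P = k \<and> disjoint P"
      then obtain P where P: "P \<subseteq> hosts H G" "card P = k" by blast
      have "P \<subseteq> (\<lambda>v. {v}) ` {..<n}" using P(1) hosts_le by blast
      then have "card P \<le> card ((\<lambda>v. {v}) ` {..<n})" by (intro card_mono) auto
      also have "\<dots> \<le> n" using card_image_le[of "{..<n}" "\<lambda>v. {v}"] by simp
      finally show "k \<le> n" using P by simp
    next
      assume "k \<le> n"
      then show "\<exists>P \<subseteq> hosts H G. finite P \<and> card P = k \<and> disjoint P"
        using in_hosts
        by (intro exI[of _ "(\<lambda>v. {v}) ` {..<k}"]) (auto simp: card_image disjoint_def)
    qed
    moreover have "(?E, of_bool (n < k)) \<in> H_packing H \<longleftrightarrow> k \<le> n"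
    proof -
      have "hosts H ?E = {}" using hosts_card[OF sE, of _ H] pos by (auto simp: hosts_def)
      then show ?thesis unfolding H_packing_iff[OF H sE pos] by auto
    qed
    ultimately show ?thesis using d1 by simp
  qed
  then have "kernelizes H (trivial_stm d) G k ?E (of_bool (n < d * k))"
    unfolding kernelizes_def Let_def by (simp add: trivial_stm_def graph_code_def n)
  then show ?thesis using E unfolding d_def by blast
qed

lemma exists_kernel_stm:
  assumes "simple_graph H"
  shows "\<exists>c. wf_stm 1 c \<and> stm_depth c \<le> card (verts H) * (card (verts H) + 1) \<and>
    (\<forall>G\<in>input_graphs. \<forall>k. \<exists>G'\<in>input_graphs. \<exists>k'. kernelizes H c G k G' k')"
proof (cases "card (verts H) \<le> 1")
  case True
  have "wf_stm 1 (trivial_stm d)" "stm_depth (trivial_stm d) = 0" for d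
    by (auto simp: trivial_stm_def)
  then show ?thesis using kernelizes_trivial[OF assms True] by (metis le0)
next
  case False
  obtain hs where hs: "set hs = verts H" "distinct hs"
    using assms finite_distinct_list[of "verts H"] by (auto simp: simple_graph_def)
  interpret pattern H hs "length hs" using assms hs by unfold_locales auto
  have d: "2 \<le> length hs" using False card_H by simp
  have "\<exists>G'\<in>input_graphs. \<exists>k'. kernelizes H kernel_stm G k G' k'" if G: "G \<in> input_graphs" for G k
  proof -
    obtain n where n: "verts G = {..<n}" using G by (auto simp: input_graphs_def)
    interpret pattern_in_graph H hs "length hs" G k n "length hs * (k - 1) + 1" "k # graph_code G"
      using G n by unfold_locales auto
    show ?thesis by (rule kernelizes_kernel[OF d])
  qed
  then show ?thesis using wf_kernel depth_kernel[OF d] card_H by auto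
qed

text \<open>For \<open>0 < d \<le> n\<close>, the factor \<open>2 ^ d\<close> comes from
  \<open>Suc n \<le> 2 * n\<close> and \<open>d ^ d\<close> from
  \<open>(n / d) ^ d \<le> n choose d\<close>. For \<open>n < d\<close> the coefficient vanishes,
  but then \<open>Suc n \<le> d\<close>, and \<open>max 1\<close> keeps the right side large
  enough.\<close>

lemma power_le_binomial: "Suc n ^ d \<le> (2 * d) ^ d * max 1 (n choose d)"
proof (cases "d \<le> n \<and> 0 < d")
  case True
  then have "(real n / real d) ^ d \<le> real (n choose d)" by (intro binomial_ge_n_over_k_pow_k) simp
  then have "real n ^ d \<le> real d ^ d * real (n choose d)"
    using True by (simp add: power_divide pos_divide_le_eq mult.commute)
  then have "real (n ^ d) \<le> real (d ^ d * (n choose d))" by simp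
  then have "n ^ d \<le> d ^ d * (n choose d)" by (simp only: of_nat_le_iff)
  have "Suc n ^ d \<le> (2 * n) ^ d" using True by (intro power_mono) auto
  also have "\<dots> = 2 ^ d * n ^ d" by (rule power_mult_distrib)
  also have "\<dots> \<le> 2 ^ d * (d ^ d * (n choose d))" using \<open>n ^ d \<le> _\<close> by simp
  also have "\<dots> = (2 * d) ^ d * (n choose d)" by (simp add: power_mult_distrib)
  also have "\<dots> \<le> (2 * d) ^ d * max 1 (n choose d)" by (intro mult_le_mono2) simp
  finally show ?thesis .
next
  case False
  then have "d = 0 \<or> Suc n \<le> 2 * d" by linarith
  then have "Suc n ^ d \<le> (2 * d) ^ d" using power_mono[of "Suc n" "2 * d" d] by auto
  also have "\<dots> \<le> (2 * d) ^ d * max 1 (n choose d)" by simp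
  finally show ?thesis .
qed

lemma nbits_le_self: "nbits n \<le> n + 1"
  by (rule nbits_le) (use less_exp[of "n + 1"] in auto)

lemma length_graph_code: "verts G = {..<n} \<Longrightarrow> length (graph_code G) = Suc (n * n)"
  by (simp add: graph_code_def Let_def)

lemma graph_code_entry: "w \<in> set (graph_code G) \<Longrightarrow> w = card (verts G) \<or> w \<le> 1"
  by (auto simp: graph_code_def Let_def of_bool_def split: if_splits)

text \<open>Each of the \<open>n * n + 1\<close> entries takes at least one bit. Thus powers of
  \<open>n + 1\<close> become powers of the input size.\<close>

lemma code_size_ge:
  assumes "verts G = {..<n}"
  shows "n + 1 \<le> code_size (graph_code G)"
proof -
  have "length xs \<le> code_size xs" for xs
    unfolding code_size_def by (induction xs) (use nbits_pos in \<open>auto simp: nbits_def\<close>)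
  from this[of "graph_code G"] show ?thesis
    unfolding length_graph_code[OF assms] using le_square[of n] by linarith
qed

lemma code_size_le:
  assumes "verts G = {..<n}"
  shows "code_size (graph_code G) \<le> n + 1 + n * n"
proof -
  have "sum_list (map nbits (map (\<lambda>(i, j). of_bool (Q i j)) ps)) = length ps" for Q and ps :: "(nat \<times> nat) list"
    by (induction ps) (auto simp: nbits_def of_bool_def)
  then show ?thesis
    unfolding code_size_def graph_code_def using nbits_le_self[of n] by (simp add: assms Let_def del: map_map)
qed

text \<open>With \<open>N = d * (d * k + 1) ^ d\<close> vertices a code has at most
  \<open>N * N + N + 1\<close> bits, and \<open>k + 1\<close> is added for the new parameter. The
  formula is a loop-free expression in \<open>k\<close>, so the compiler already built proves it
  computable.\<close>

lemma computable_kernel_size: "computable (\<lambda>k. (d * (d * k + 1) ^ d) * (d * (d * k + 1) ^ d) + d * (d * k + 1) ^ d + k + 2)"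
proof -
  define A where "A = Op TimesOp (N d) (pow_exp (Op PlusOp (Op TimesOp (N d) (Rd (N 0))) (N 1)) d)"
  define c where "c = Wr (Op PlusOp (Op PlusOp (Op PlusOp (Op TimesOp A A) A) (Rd (N 0))) (N 2))"
  have "wf_stm 1 c" by (simp add: c_def A_def wf_pow)
  then obtain P K where "\<forall>x Y. (\<forall>w\<in>set x. w \<le> Y) \<longrightarrow> (\<exists>t b.
    computes P x (out x c ((\<lambda>_. 0)(0 := instance_size x))) t b \<and>
    t \<le> K * Suc (instance_size x) ^ stm_depth c \<and> b \<le> K * nbits Y)"
    using stm_computable by blast
  then have P: "\<exists>t b. computes P x (out x c ((\<lambda>_. 0)(0 := instance_size x))) t b" for x
    using member_le_sum_list[of _ x] by blast
  have "out [k] c s = [(d * (d * k + 1) ^ d) * (d * (d * k + 1) ^ d) + d * (d * k + 1) ^ d + k + 2]" for k s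
    by (simp add: c_def A_def)
  then show ?thesis unfolding computable_def using P by metis
qed

theorem theorem5:
  fixes H :: "'a ugraph" and d :: nat
  assumes "simple_graph H" and "d = card (verts H)"
  shows "\<exists>P. logspace_kernelization graph_code input_graphs (H_packing H) P \<and>
    (\<exists>C. \<forall>G\<in>input_graphs. \<forall>G'\<in>input_graphs. \<forall>k k' t b.
       transforms graph_code P (G, k) (G', k') t b \<longrightarrow>
         t \<le> C * (max 1 (card (edges G)) * (max 1 (card (verts G) choose d)) ^ (d + 1)) \<and>
         card (edges G') \<le> d * (d - 1) div 2 * (d * (k - 1) + 1) ^ d)"
proof -
  obtain c where c: "wf_stm 1 c" "stm_depth c \<le> d * (d + 1)"
    and ker: "\<And>G k. G \<in> input_graphs \<Longrightarrow> \<exists>G'\<in>input_graphs. \<exists>k'. kernelizes H c G k G' k'"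
    using exists_kernel_stm[OF assms(1)] assms(2) by blast
  obtain P K where PK: "\<And>x Y. (\<forall>w\<in>set x. w \<le> Y) \<Longrightarrow> \<exists>t b.
    computes P x (out x c ((\<lambda>_. 0)(0 := instance_size x))) t b \<and>
    t \<le> K * Suc (instance_size x) ^ stm_depth c \<and> b \<le> K * nbits Y"
    using stm_computable[OF c(1)] by blast
  have main: "\<exists>G'\<in>input_graphs. \<exists>k' t b. transforms graph_code P (G, k) (G', k') t b \<and>
      kernelizes H c G k G' k' \<and> t \<le> K * Suc (card (verts G)) ^ (d * (d + 1)) \<and>
      b \<le> K * nbits (code_size (graph_code G) + k)" if G: "G \<in> input_graphs" for G k
  proof -
    let ?x = "k # graph_code G"
    obtain n where n: "verts G = {..<n}" using G by (auto simp: input_graphs_def)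
    have size: "instance_size ?x = card (verts G)"
      by (simp add: instance_size_def graph_code_def Let_def)
    have card: "card (verts G) + 1 \<le> code_size (graph_code G)" using code_size_ge[OF n] n by simp
    have "w \<le> code_size (graph_code G) + k" if "w \<in> set ?x" for w
    proof -
      have "w = k \<or> w = card (verts G) \<or> w \<le> 1" using that graph_code_entry[of w G] by auto
      then show ?thesis using card by linarith
    qed
    \<comment> \<open>The value bound \<open>Y\<close> is the instance size, with \<open>k\<close>
      counted by value, so that \<open>K * nbits Y\<close> is literally the logarithmic space
      bound.\<close>
    then have "\<forall>w\<in>set ?x. w \<le> code_size (graph_code G) + k" by blast
    from PK[OF this, unfolded size] obtain t b where tb: "computes P ?x (out ?x c ((\<lambda>_. 0)(0 := card (verts G)))) t b"
      "t \<le> K * Suc (card (verts G)) ^ stm_depth c" "b \<le> K * nbits (code_size (graph_code G) + k)"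
      by blast
    have "K * Suc (card (verts G)) ^ stm_depth c \<le> K * Suc (card (verts G)) ^ (d * (d + 1))"
      using c(2) by (intro mult_le_mono2 power_increasing) auto
    then have t: "t \<le> K * Suc (card (verts G)) ^ (d * (d + 1))" using tb(2) by linarith
    obtain G' k' where G': "G' \<in> input_graphs" "kernelizes H c G k G' k'" using ker[OF G] by blast
    then have "transforms graph_code P (G, k) (G', k') t b"
      using tb(1) by (simp add: transforms_def kernelizes_def Let_def)
    then show ?thesis using G' t tb(3) by blast
  qed
  have "kernelization graph_code input_graphs (H_packing H) P"
    unfolding kernelization_def
  proof (intro exI conjI ballI allI)
    let ?g = "\<lambda>k. (d * (d * k + 1) ^ d) * (d * (d * k + 1) ^ d) + d * (d * k + 1) ^ d + k + 2"
    let ?c = "max K (d * (d + 1))"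
    show "computable ?g" by (rule computable_kernel_size)
    fix G k assume G: "G \<in> input_graphs"
    obtain n where n: "verts G = {..<n}" using G by (auto simp: input_graphs_def)
    obtain G' k' t b where G': "G' \<in> input_graphs" "transforms graph_code P (G, k) (G', k') t b"
      "kernelizes H c G k G' k'" "t \<le> K * Suc (card (verts G)) ^ (d * (d + 1))"
      using main[OF G] by blast
    have "K * Suc (card (verts G)) ^ (d * (d + 1)) \<le> ?c * (code_size (graph_code G) + k) ^ ?c"
    proof (rule mult_le_mono)
      have "Suc (card (verts G)) \<le> code_size (graph_code G) + k" using code_size_ge[OF n] n by simp
      then have "Suc (card (verts G)) ^ (d * (d + 1)) \<le> (code_size (graph_code G) + k) ^ (d * (d + 1))"
        by (intro power_mono) auto
      also have "\<dots> \<le> (code_size (graph_code G) + k) ^ ?c"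
        using code_size_ge[OF n] by (intro power_increasing) auto
      finally show "Suc (card (verts G)) ^ (d * (d + 1)) \<le> (code_size (graph_code G) + k) ^ ?c" .
    qed simp
    then have t: "t \<le> ?c * (code_size (graph_code G) + k) ^ ?c + ?c" using G'(4) by linarith
    obtain n' where n': "verts G' = {..<n'}" using G'(1) by (auto simp: input_graphs_def)
    have bound: "n' \<le> d * (d * k + 1) ^ d" "k' \<le> k + 1"
      using G'(3) n' assms(2) by (simp_all add: kernelizes_def Let_def)
    have "n' * n' \<le> (d * (d * k + 1) ^ d) * (d * (d * k + 1) ^ d)"
      by (rule mult_le_mono[OF bound(1) bound(1)])
    then have size: "code_size (graph_code G') + k' \<le> ?g k"
      using code_size_le[OF n'] bound by linarith
    have "(G, k) \<in> H_packing H \<longleftrightarrow> (G', k') \<in> H_packing H"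
      using G'(3) by (simp add: kernelizes_def Let_def)
    then show "\<exists>G'\<in>input_graphs. \<exists>k' t b. transforms graph_code P (G, k) (G', k') t b \<and>
       t \<le> ?c * (code_size (graph_code G) + k) ^ ?c + ?c \<and> code_size (graph_code G') + k' \<le> ?g k \<and>
       ((G, k) \<in> H_packing H \<longleftrightarrow> (G', k') \<in> H_packing H)"
      using G'(1,2) t size by blast
  qed
  moreover have "\<exists>c. \<forall>G\<in>input_graphs. \<forall>k. \<exists>ys t b.
      computes P (k # graph_code G) ys t b \<and> b \<le> c * nbits (code_size (graph_code G) + k)"
  proof (intro exI[of _ K] ballI allI)
    fix G :: "nat ugraph" and k
    assume "G \<in> input_graphs"
    from main[OF this, of k] obtain G' k' t b where
      "transforms graph_code P (G, k) (G', k') t b" "b \<le> K * nbits (code_size (graph_code G) + k)"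
      by blast
    then show "\<exists>ys t b. computes P (k # graph_code G) ys t b \<and>
        b \<le> K * nbits (code_size (graph_code G) + k)"
      unfolding transforms_def fst_conv snd_conv by blast
  qed
  ultimately have "logspace_kernelization graph_code input_graphs (H_packing H) P"
    unfolding logspace_kernelization_def by blast
  moreover have "\<exists>C. \<forall>G\<in>input_graphs. \<forall>G'\<in>input_graphs. \<forall>k k' t b.
       transforms graph_code P (G, k) (G', k') t b \<longrightarrow>
         t \<le> C * (max 1 (card (edges G)) * (max 1 (card (verts G) choose d)) ^ (d + 1)) \<and>
         card (edges G') \<le> d * (d - 1) div 2 * (d * (k - 1) + 1) ^ d"
  proof (intro exI ballI allI impI)
    fix G G' :: "nat ugraph" and k k' t b
    assume G: "G \<in> input_graphs" "G' \<in> input_graphs" and tr: "transforms graph_code P (G, k) (G', k') t b"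
    obtain G'' k'' t' b' where G'': "G'' \<in> input_graphs" "transforms graph_code P (G, k) (G'', k'') t' b'"
      "kernelizes H c G k G'' k''" "t' \<le> K * Suc (card (verts G)) ^ (d * (d + 1))"
      using main[OF G(1)] by blast
    obtain s' where s': "run (k # graph_code G) (regs P) P (\<lambda>_. 0) (k' # graph_code G') t b s'"
      using tr unfolding transforms_def computes_def fst_conv snd_conv by blast
    obtain s'' where s'': "run (k # graph_code G) (regs P) P (\<lambda>_. 0) (k'' # graph_code G'') t' b' s''"
      using G''(2) unfolding transforms_def computes_def fst_conv snd_conv by blast
    \<comment> \<open>The claim concerns every computation of \<open>P\<close>, whereas
      \<open>main\<close> provides one. Determinism identifies outputs and times, and injectivity of
      \<open>graph_code\<close> then identifies the graphs.\<close>
    have same: "k' # graph_code G' = k'' # graph_code G''" "t = t'"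
      using run_deterministic[OF s'' s'] by simp_all
    then have "G' = G''" using inj_on_graph_code G(2) G''(1) by (auto dest: inj_onD)
    then have e: "card (edges G') \<le> d * (d - 1) div 2 * (d * (k - 1) + 1) ^ d"
      using G''(3) assms(2) by (simp add: kernelizes_def Let_def)
    let ?n = "card (verts G)"
    let ?B = "max 1 (?n choose d)"
    \<comment> \<open>Regrouping the exponent leaves \<open>Suc ?n ^ d\<close>, which is comparable
      to the binomial coefficient, to the power \<open>d + 1\<close>.\<close>
    have "Suc ?n ^ (d * (d + 1)) = (Suc ?n ^ d) ^ (d + 1)" by (rule power_mult)
    also have "\<dots> \<le> ((2 * d) ^ d * ?B) ^ (d + 1)" by (rule power_mono[OF power_le_binomial]) simp
    also have "\<dots> = ((2 * d) ^ d) ^ (d + 1) * ?B ^ (d + 1)" by (rule power_mult_distrib)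
    also have "\<dots> \<le> ((2 * d) ^ d) ^ (d + 1) * (max 1 (card (edges G)) * ?B ^ (d + 1))"
      by (intro mult_le_mono2) simp
    finally have "K * Suc ?n ^ (d * (d + 1)) \<le>
       K * (((2 * d) ^ d) ^ (d + 1) * (max 1 (card (edges G)) * ?B ^ (d + 1)))" by simp
    then have "t \<le> K * ((2 * d) ^ d) ^ (d + 1) * (max 1 (card (edges G)) * ?B ^ (d + 1))"
      using same(2) G''(4) unfolding mult.assoc by linarith
    then show "t \<le> K * ((2 * d) ^ d) ^ (d + 1) * (max 1 (card (edges G)) * ?B ^ (d + 1)) \<and>
         card (edges G') \<le> d * (d - 1) div 2 * (d * (k - 1) + 1) ^ d"
      using e by blast
  qed
  ultimately show ?thesis by blast
qed

end
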